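(* For $\alpha,\beta\in\mathbb{R}^{+}$, the Laplace transform of the hypergeometric-Mittag-Leffler function is $$\mathcal{L}\big\{{}_{{}_2F_1}E_{(\alpha,\beta)}(a_1,a_2;b_1;-t):s\big\}=\frac1s\;{}_{{}_3F_1}E_{(\alpha,\beta)}\!\left(a_1,a_2,1;\,b_1;\,-\frac1s\right).$$
   Context: $(a)_r=\Gamma(a+r)/\Gamma(a)$ is the Pochhammer symbol. The generalized hypergeometric-Mittag-Leffler functions are given by $${}_{{}_pF_q}E_{(\alpha,\beta)}(a_1,\dots,a_p;b_1,\dots,b_q;u)=\sum_{r=0}^{\infty}\frac{(a_1)_r\cdots(a_p)_r}{(b_1)_r\cdots(b_q)_r}\,\frac{u^r}{\Gamma(\alpha r+\beta)} ;$$ the case $p=2$, $q=1$ is the hypergeometric-Mittag-Leffler function. The Laplace transform of a function $f(t)$, $t>0$, is $\mathcal{L}\{f(t):s\}=\int_0^\infty e^{-st}f(t)\,dt$, provided the limit exists.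
   Formalization: As stated the formula can be undefined (e.g. α=β=a₁=a₂=b₁=1, where the right-hand series diverges for all s); it is proved for complex parameters with b₁ not in {0,-1,-2,…}, Re s>0, and the series on the right convergent at -1/s. *)

theory Defs
  imports "HOL-Analysis.Analysis"
begin

text \<open>
  The Pochhammer symbol \<open>(a)\<^sub>r\<close> is the library's rising factorial \<^const>\<open>pochhammer\<close>, which equals
  \<open>\<Gamma>(a + r) / \<Gamma>(a)\<close> away from the poles of \<open>\<Gamma>\<close> and extends it continuously to \<open>a = 0, -1, -2, \<dots>\<close>.
  The lists \<open>as\<close> and \<open>bs\<close> hold the numerator and denominator parameters, so \<open>p = length as\<close> and
  \<open>q = length bs\<close>.
\<close>

definition hyp_ML_term ::
    "complex list \<Rightarrow> complex list \<Rightarrow> real \<Rightarrow> real \<Rightarrow> complex \<Rightarrow> nat \<Rightarrow> complex" where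
  "hyp_ML_term as bs \<alpha> \<beta> u r =
     (\<Prod>a\<leftarrow>as. pochhammer a r) / (\<Prod>b\<leftarrow>bs. pochhammer b r)
       * (u ^ r / Gamma (complex_of_real (\<alpha> * real r + \<beta>)))"

text \<open>The value is meaningful only where the series of terms is \<^const>\<open>summable\<close>.\<close>

definition hyp_ML ::
    "complex list \<Rightarrow> complex list \<Rightarrow> real \<Rightarrow> real \<Rightarrow> complex \<Rightarrow> complex" where
  "hyp_ML as bs \<alpha> \<beta> u = (\<Sum>r. hyp_ML_term as bs \<alpha> \<beta> u r)"

text \<open>
  The integral over \<open>(0, \<infinity>)\<close> is the limit of the integrals over \<open>[0, T]\<close> as \<open>T \<rightarrow> \<infinity>\<close>; absolute
  convergence is not required. The value of \<open>f\<close> at \<open>0\<close> is irrelevant.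
\<close>

definition has_laplace_transform ::
    "(real \<Rightarrow> complex) \<Rightarrow> complex \<Rightarrow> complex \<Rightarrow> bool" where
  "has_laplace_transform f s L \<longleftrightarrow>
     (\<forall>T>0. (\<lambda>t. exp (- s * complex_of_real t) * f t) integrable_on {0..T}) \<and>
     ((\<lambda>T. integral {0..T} (\<lambda>t. exp (- s * complex_of_real t) * f t)) \<longlongrightarrow> L) at_top"

end

theory Submission
  imports Defs "HOL-Complex_Analysis.Complex_Analysis" "HOL-Real_Asymp.Real_Asymp"
begin

text \<open>
  Write the two sides as \<open>f t = (\<Sum>r. u\<^sub>r t\<^sup>r)\<close> and \<open>1/s (\<Sum>r. r! u\<^sub>r s\<^sup>-\<^sup>r)\<close>. The second series
  may converge, even just conditionally, at points \<open>s\<close> with \<open>Re s\<close> so small that termwise integration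
  is not justified by absolute convergence. What is needed in addition is that \<open>f\<close> grows
  subexponentially on the positive axis: then the Laplace integral is holomorphic for \<open>Re s > 0\<close>,
  and the identity follows from the trivial case of large real \<open>s\<close> by analytic continuation and
  Abel's limit theorem.

  For \<open>\<alpha> < 2\<close> convergence forces the series to terminate, and for \<open>\<alpha> > 2\<close> the coefficients \<open>r! u\<^sub>r\<close>
  decay superexponentially, so growth is clear. For \<open>\<alpha> = 2\<close> the duplication formula turns a tail of
  \<open>f\<close> into a \<open>\<^sub>3F\<^sub>3\<close> function of \<open>-t/4\<close>, obtained from \<open>exp (-t/4)\<close> by three multipliers
  \<open>(a)\<^sub>r/(b)\<^sub>r\<close>. Each multiplier is a Beta-kernel average of \<open>f (x t)\<close> over \<open>0 < x < 1\<close>, possibly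
  composed with operators \<open>t d/dt + c\<close>, and these preserve subexponential growth.
\<close>

section \<open>Laplace integrals of functions of subexponential growth\<close>

definition subexponential :: "(real \<Rightarrow> complex) \<Rightarrow> bool" where
  "subexponential f \<longleftrightarrow> (\<forall>\<epsilon>>0. \<exists>C. \<forall>t\<ge>0. norm (f t) \<le> C * exp (\<epsilon> * t))"

lemma subexponentialE:
  assumes "subexponential f" "\<epsilon> > 0"
  obtains C where "C \<ge> 0" "\<And>t. t \<ge> 0 \<Longrightarrow> norm (f t) \<le> C * exp (\<epsilon> * t)"
proof -
  obtain C where C: "\<And>t. t \<ge> 0 \<Longrightarrow> norm (f t) \<le> C * exp (\<epsilon> * t)"
    using assms unfolding subexponential_def by blast
  have "0 \<le> norm (f 0)" by simp
  also have "\<dots> \<le> C" using C[of 0] by simp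
  finally show ?thesis using C that by blast
qed

lemma subexponential_const: "subexponential (\<lambda>t. c)"
  unfolding subexponential_def
proof (intro allI impI exI)
  fix \<epsilon> t :: real
  assume "\<epsilon> > 0" "t \<ge> 0"
  hence "norm c * 1 \<le> norm c * exp (\<epsilon> * t)"
    by (intro mult_left_mono) auto
  thus "norm c \<le> norm c * exp (\<epsilon> * t)" by simp
qed

lemma subexponential_add:
  assumes "subexponential f" "subexponential g"
  shows "subexponential (\<lambda>t. f t + g t)"
  unfolding subexponential_def
proof (intro allI impI)
  fix \<epsilon> :: real assume \<epsilon>: "\<epsilon> > 0"
  obtain C where C: "\<And>t. t \<ge> 0 \<Longrightarrow> norm (f t) \<le> C * exp (\<epsilon> * t)"
    using subexponentialE[OF assms(1) \<epsilon>] by blast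
  obtain D where D: "\<And>t. t \<ge> 0 \<Longrightarrow> norm (g t) \<le> D * exp (\<epsilon> * t)"
    using subexponentialE[OF assms(2) \<epsilon>] by blast
  have "norm (f t + g t) \<le> (C + D) * exp (\<epsilon> * t)" if "t \<ge> 0" for t
    using norm_triangle_ineq[of "f t" "g t"] C[OF that] D[OF that] by (simp add: algebra_simps)
  thus "\<exists>C. \<forall>t\<ge>0. norm (f t + g t) \<le> C * exp (\<epsilon> * t)" by blast
qed

lemma subexponential_mult:
  assumes "subexponential f" "subexponential g"
  shows "subexponential (\<lambda>t. f t * g t)"
  unfolding subexponential_def
proof (intro allI impI)
  fix \<epsilon> :: real assume \<epsilon>: "\<epsilon> > 0"
  \<comment> \<open>Rates add under multiplication, so each factor gets half of
    \<open>\<epsilon>\<close>.\<close>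
  hence \<epsilon>': "\<epsilon> / 2 > 0" by simp
  obtain C where C: "C \<ge> 0" "\<And>t. t \<ge> 0 \<Longrightarrow> norm (f t) \<le> C * exp (\<epsilon> / 2 * t)"
    using subexponentialE[OF assms(1) \<epsilon>'] by blast
  obtain D where D: "\<And>t. t \<ge> 0 \<Longrightarrow> norm (g t) \<le> D * exp (\<epsilon> / 2 * t)"
    using subexponentialE[OF assms(2) \<epsilon>'] by blast
  have "norm (f t * g t) \<le> (C * D) * exp (\<epsilon> * t)" if "t \<ge> 0" for t
  proof -
    have "norm (f t * g t) \<le> (C * exp (\<epsilon> / 2 * t)) * (D * exp (\<epsilon> / 2 * t))"
      unfolding norm_mult using C D that by (intro mult_mono) auto
    also have "\<dots> = (C * D) * exp (\<epsilon> * t)" by (simp flip: exp_add)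
    finally show ?thesis .
  qed
  thus "\<exists>C. \<forall>t\<ge>0. norm (f t * g t) \<le> C * exp (\<epsilon> * t)" by blast
qed

lemma subexponential_sum:
  assumes "\<And>i. i \<in> I \<Longrightarrow> subexponential (f i)"
  shows "subexponential (\<lambda>t. \<Sum>i\<in>I. f i t)"
  using assms
  by (induction I rule: infinite_finite_induct) (auto intro: subexponential_add subexponential_const)

lemma subexponential_of_real: "subexponential complex_of_real"
  unfolding subexponential_def
proof (intro allI impI exI)
  fix \<epsilon> t :: real
  assume "\<epsilon> > 0" "t \<ge> 0"
  thus "norm (complex_of_real t) \<le> 1 / \<epsilon> * exp (\<epsilon> * t)"
    using exp_ge_add_one_self[of "\<epsilon> * t"] by (simp add: field_simps del: exp_ge_add_one_self)
qed

lemma subexponential_power: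
  assumes "subexponential f"
  shows "subexponential (\<lambda>t. f t ^ n)"
  by (induction n) (auto intro: subexponential_const subexponential_mult assms)

lemmas subexponential_intros =
  subexponential_const subexponential_add subexponential_mult subexponential_sum
  subexponential_of_real subexponential_power

section \<open>Convergence and holomorphy of the Laplace integral\<close>

lemma exp_decay_integral_tail:
  fixes g :: "real \<Rightarrow> complex"
  assumes cont: "continuous_on {0..} g"
    and bound: "\<And>t. t \<ge> 0 \<Longrightarrow> norm (g t) \<le> C * exp (- \<delta> * t)" and "\<delta> > 0" and "T \<ge> 0"
  shows "g integrable_on {0..}"
    and "norm (integral {0..T} g - integral {0..} g) \<le> C * (exp (- \<delta> * T) / \<delta>)"
proof -
  \<comment> \<open>Integrability is needed from 0 and from \<open>T\<close>: the truncation error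
    at \<open>T\<close> is the integral over \<open>{T..}\<close>, which the integral of the
    majorant bounds.\<close>
  have int: "g integrable_on {c..}" if "c \<ge> 0" for c
  proof (rule measurable_bounded_by_integrable_imp_integrable)
    show "g \<in> borel_measurable (lebesgue_on {c..})"
      using that by (intro continuous_imp_measurable_on_sets_lebesgue continuous_on_subset[OF cont]) auto
    show "(\<lambda>t. C * exp (- \<delta> * t)) integrable_on {c..}"
      by (intro integrable_on_mult_right integrable_on_exp_minus_to_infinity \<open>\<delta> > 0\<close>)
    show "norm (g x) \<le> C * exp (- \<delta> * x)" if "x \<in> {c..}" for x
      using that \<open>c \<ge> 0\<close> by (intro bound) auto
  qed auto
  show "g integrable_on {0..}" by (rule int) simp
  have "g integrable_on {0..T}"
    by (intro integrable_continuous_interval continuous_on_subset[OF cont]) auto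
  moreover have "{0..T} \<inter> {T..} = {T}" using \<open>T \<ge> 0\<close> by auto
  ultimately have "(g has_integral (integral {0..T} g + integral {T..} g)) ({0..T} \<union> {T..})"
    using int[OF \<open>T \<ge> 0\<close>] by (intro has_integral_Un integrable_integral) auto
  also have "{0..T} \<union> {T..} = {0..}" using \<open>T \<ge> 0\<close> by auto
  finally have "norm (integral {0..T} g - integral {0..} g) = norm (integral {T..} g)"
    by (simp add: integral_unique)
  also have "\<dots> \<le> integral {T..} (\<lambda>t. C * exp (- \<delta> * t))"
    using \<open>T \<ge> 0\<close>
    by (intro integral_norm_bound_integral int bound integrable_on_mult_right
          integrable_on_exp_minus_to_infinity \<open>\<delta> > 0\<close>) auto
  also have "\<dots> = C * (exp (- \<delta> * T) / \<delta>)"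
    by (intro integral_unique has_integral_mult_right has_integral_exp_minus_to_infinity \<open>\<delta> > 0\<close>)
  finally show "norm (integral {0..T} g - integral {0..} g) \<le> C * (exp (- \<delta> * T) / \<delta>)" .
qed

text \<open>One \<open>\<delta>\<close> of the real part of \<open>s\<close> absorbs the growth of
  \<open>f\<close>; the other is left as exponential decay.\<close>

lemma norm_exp_mult_le:
  assumes "\<And>t. t \<ge> 0 \<Longrightarrow> norm (f t) \<le> C * exp (\<delta> * t)" "Re s \<ge> 2 * \<delta>" "t \<ge> 0"
  shows "norm (exp (- s * complex_of_real t) * f t) \<le> C * exp (- \<delta> * t)"
proof -
  have "0 \<le> C * exp (\<delta> * t)" using assms(1)[OF assms(3)] norm_ge_zero order_trans by blast
  hence "norm (exp (- s * complex_of_real t) * f t) \<le> exp (- (2 * \<delta>) * t) * (C * exp (\<delta> * t))"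
    unfolding norm_mult using assms by (intro mult_mono) (auto intro: mult_right_mono)
  also have "\<dots> = C * exp (- \<delta> * t)" by (simp flip: exp_add)
  finally show ?thesis .
qed

definition laplace_integral :: "(real \<Rightarrow> complex) \<Rightarrow> complex \<Rightarrow> complex" where
  "laplace_integral f s = integral {0..} (\<lambda>t. exp (- s * complex_of_real t) * f t)"

lemma has_laplace_transform_laplace_integral:
  assumes cont: "continuous_on {0..} f" and sub: "subexponential f" and s: "Re s > 0"
  shows "has_laplace_transform f s (laplace_integral f s)"
proof -
  define g where "g = (\<lambda>t. exp (- s * complex_of_real t) * f t)"
  define \<delta> where "\<delta> = Re s / 2"
  have \<delta>: "\<delta> > 0" "Re s \<ge> 2 * \<delta>" using s by (auto simp: \<delta>_def)
  obtain C where C: "\<And>t. t \<ge> 0 \<Longrightarrow> norm (f t) \<le> C * exp (\<delta> * t)"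
    using subexponentialE[OF sub \<delta>(1)] by blast
  have contg: "continuous_on {0..} g" unfolding g_def by (intro continuous_intros cont)
  note tail = exp_decay_integral_tail[OF contg, of C \<delta>,
      OF norm_exp_mult_le[OF C \<delta>(2), folded fun_cong[OF g_def]] \<delta>(1)]
  have "((\<lambda>T. integral {0..T} g) \<longlongrightarrow> integral {0..} g) at_top"
  proof (rule Lim_transform2[OF tendsto_const])
    have "((\<lambda>T. C * (exp (- \<delta> * T) / \<delta>)) \<longlongrightarrow> 0) at_top"
      using \<delta>(1) by real_asymp
    thus "((\<lambda>T. integral {0..} g - integral {0..T} g) \<longlongrightarrow> 0) at_top"
      by (rule Lim_null_comparison[rotated])
         (use tail(2) in \<open>auto simp: eventually_at_top_linorder norm_minus_commute\<close>)
  qed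
  moreover have "g integrable_on {0..T}" for T
    by (intro integrable_continuous_interval continuous_on_subset[OF contg]) auto
  ultimately show "has_laplace_transform f s (laplace_integral f s)"
    unfolding has_laplace_transform_def laplace_integral_def g_def by blast
qed

text \<open>The integrals over \<open>{0..n}\<close> are holomorphic by differentiation under the
  integral sign, and they converge locally uniformly because the tail bound depends on
  \<open>s\<close> only through a lower bound for \<open>Re s\<close>.\<close>

lemma laplace_integral_holomorphic:
  assumes cont: "continuous_on {0..} f" and sub: "subexponential f"
  shows "laplace_integral f holomorphic_on {s. Re s > 0}"
proof (rule holomorphic_uniform_sequence)
  show "open {s. Re s > 0}" by (rule open_halfspace_Re_gt)
  define F where "F = (\<lambda>n::nat. \<lambda>s. integral {0..real n} (\<lambda>t. exp (- s * complex_of_real t) * f t))"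
  have contf: "continuous_on {0..real n} f" for n by (rule continuous_on_subset[OF cont]) auto
  show "F n holomorphic_on {s. Re s > 0}" for n
    unfolding F_def box_real(2)[symmetric]
  proof (rule leibniz_rule_holomorphic)
    fix s t
    show "((\<lambda>s. exp (- s * complex_of_real t) * f t) has_field_derivative
            (- of_real t * exp (- s * complex_of_real t) * f t)) (at s within {s. Re s > 0})"
      by (auto intro!: derivative_eq_intros)
  next
    fix s
    show "(\<lambda>t. exp (- s * complex_of_real t) * f t) integrable_on cbox 0 (real n)"
      unfolding box_real by (intro integrable_continuous_interval continuous_intros contf)
  next
    show "continuous_on ({s. Re s > 0} \<times> cbox 0 (real n))
            (\<lambda>(s, t). - of_real t * exp (- s * complex_of_real t) * f t)"
      unfolding case_prod_unfold
      by (intro continuous_intros continuous_on_compose2[OF contf[of n]]) auto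
  qed (simp add: convex_halfspace_Re_gt)
  fix x :: complex assume "x \<in> {s. Re s > 0}"
  \<comment> \<open>The ball of radius \<open>2 * \<delta>\<close> then has radius
    \<open>Re x / 2\<close>, so \<open>Re s \<ge> 2 * \<delta>\<close> holds on all of it, as
    \<open>norm_exp_mult_le\<close> demands.\<close>
  define \<delta> where "\<delta> = Re x / 4"
  have \<delta>: "\<delta> > 0" using \<open>x \<in> _\<close> by (simp add: \<delta>_def)
  have Re: "Re s \<ge> 2 * \<delta>" if "s \<in> cball x (2 * \<delta>)" for s
    using abs_Re_le_cmod[of "x - s"] that by (auto simp: \<delta>_def dist_norm)
  obtain C where C: "\<And>t. t \<ge> 0 \<Longrightarrow> norm (f t) \<le> C * exp (\<delta> * t)"
    using subexponentialE[OF sub \<delta>(1)] by blast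
  have "uniform_limit (cball x (2 * \<delta>)) F (laplace_integral f) sequentially"
    unfolding uniform_limit_iff
  proof (intro allI impI)
    fix e :: real assume "e > 0"
    have "((\<lambda>n. C * (exp (- \<delta> * real n) / \<delta>)) \<longlonglongrightarrow> 0)"
      using \<delta> by real_asymp
    hence "\<forall>\<^sub>F n in sequentially. C * (exp (- \<delta> * real n) / \<delta>) < e"
      using \<open>e > 0\<close> by (simp add: order_tendstoD)
    thus "\<forall>\<^sub>F n in sequentially. \<forall>s\<in>cball x (2 * \<delta>). dist (F n s) (laplace_integral f s) < e"
    proof eventually_elim
      case (elim n)
      show ?case
      proof
        fix s assume s: "s \<in> cball x (2 * \<delta>)"
        have "dist (F n s) (laplace_integral f s) \<le> C * (exp (- \<delta> * real n) / \<delta>)"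
          unfolding dist_norm F_def laplace_integral_def
          by (rule exp_decay_integral_tail(2)[OF _ norm_exp_mult_le[OF C Re[OF s]] \<delta>])
             (auto intro!: continuous_intros cont)
        with elim show "dist (F n s) (laplace_integral f s) < e" by simp
      qed
    qed
  qed
  moreover have "cball x (2 * \<delta>) \<subseteq> {s. Re s > 0}" using Re \<delta> by force
  ultimately show "\<exists>d>0. cball x d \<subseteq> {s. Re s > 0} \<and>
      uniform_limit (cball x d) F (laplace_integral f) sequentially"
    using \<delta> by (intro exI[of _ "2 * \<delta>"]) auto
qed

text \<open>Induction on \<open>r\<close>: integration by parts lowers the power by one, and the
  boundary term vanishes at 0 and at infinity.\<close>

lemma has_integral_power_times_exp:
  fixes x :: real
  assumes "x > 0"
  shows "((\<lambda>t. t ^ r * exp (- x * t)) has_integral (fact r / x ^ Suc r)) {0..}"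
proof (rule has_integral_to_inf)
  have int: "(\<lambda>t. t ^ r * exp (- x * t)) integrable_on {0..y}" for r y
    by (intro integrable_continuous_interval continuous_intros)
  show "(\<lambda>t. t ^ r * exp (- x * t)) integrable_on {0..y}" for y by (rule int)
  show "((\<lambda>y. integral {0..y} (\<lambda>t. t ^ r * exp (- x * t))) \<longlongrightarrow> fact r / x ^ Suc r) at_top"
  proof (induction r)
    case 0
    have "integral {0..y} (\<lambda>t. exp (- x * t)) = (1 - exp (- x * y)) / x" if "y \<ge> 0" for y
    proof -
      have "((\<lambda>t. exp (- x * t)) has_integral (- exp (- x * y) / x - (- exp (- x * 0) / x))) {0..y}"
        using that assms
        by (intro fundamental_theorem_of_calculus)
           (auto intro!: derivative_eq_intros simp flip: has_real_derivative_iff_has_vector_derivative)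
      thus ?thesis by (simp add: integral_unique diff_divide_distrib)
    qed
    moreover have "((\<lambda>y. (1 - exp (- x * y)) / x) \<longlongrightarrow> inverse x) at_top"
      using assms by real_asymp
    ultimately have "((\<lambda>y. integral {0..y} (\<lambda>t. exp (- x * t))) \<longlongrightarrow> inverse x) at_top"
      by (elim Lim_transform_eventually) (auto simp: eventually_at_top_linorder intro!: exI[of _ 0])
    thus ?case by (simp add: field_simps)
  next
    case (Suc r)
    have eq: "integral {0..y} (\<lambda>t. t ^ Suc r * exp (- x * t)) =
        (real (Suc r) * integral {0..y} (\<lambda>t. t ^ r * exp (- x * t)) - y ^ Suc r * exp (- x * y)) / x"
      if "y \<ge> 0" for y
    proof -
      have "((\<lambda>t. real (Suc r) * (t ^ r * exp (- x * t)) - x * (t ^ Suc r * exp (- x * t)))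
              has_integral (y ^ Suc r * exp (- x * y) - 0 ^ Suc r * exp (- x * 0))) {0..y}"
      proof (intro fundamental_theorem_of_calculus that)
        show "((\<lambda>t. t ^ Suc r * exp (- x * t)) has_vector_derivative
            (real (Suc r) * (t ^ r * exp (- x * t)) - x * (t ^ Suc r * exp (- x * t)))) (at t within {0..y})"
          for t
          unfolding has_real_derivative_iff_has_vector_derivative[symmetric]
          by (rule derivative_eq_intros refl)+ (simp add: algebra_simps)
      qed
      moreover have "((\<lambda>t. real (Suc r) * (t ^ r * exp (- x * t)) - x * (t ^ Suc r * exp (- x * t)))
              has_integral (real (Suc r) * integral {0..y} (\<lambda>t. t ^ r * exp (- x * t)) -
                x * integral {0..y} (\<lambda>t. t ^ Suc r * exp (- x * t)))) {0..y}"
        by (intro has_integral_diff has_integral_mult_right integrable_integral int)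
      ultimately have "real (Suc r) * integral {0..y} (\<lambda>t. t ^ r * exp (- x * t)) -
                x * integral {0..y} (\<lambda>t. t ^ Suc r * exp (- x * t)) = y ^ Suc r * exp (- x * y)"
        by (auto dest: has_integral_unique)
      thus ?thesis using assms by (simp add: field_simps)
    qed
    \<comment> \<open>The boundary term tends to 0: the exponential beats powers, first in the
      variable \<open>x * y\<close>.\<close>
    have "((\<lambda>y. (x * y) ^ Suc r / exp (x * y)) \<longlongrightarrow> 0) at_top"
      by (rule filterlim_compose[OF tendsto_power_div_exp_0])
         (intro filterlim_tendsto_pos_mult_at_top[OF tendsto_const assms] filterlim_ident)
    hence "((\<lambda>y. (x * y) ^ Suc r / exp (x * y) / x ^ Suc r) \<longlongrightarrow> 0 / x ^ Suc r) at_top"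
      by (rule tendsto_divide) (use assms in auto)
    also have "(\<lambda>y. (x * y) ^ Suc r / exp (x * y) / x ^ Suc r) = (\<lambda>y. y ^ Suc r * exp (- x * y))"
      using assms by (auto simp: power_mult_distrib exp_minus field_simps)
    finally have "((\<lambda>y. y ^ Suc r * exp (- x * y)) \<longlongrightarrow> 0) at_top" by simp
    hence "((\<lambda>y. (real (Suc r) * integral {0..y} (\<lambda>t. t ^ r * exp (- x * t)) - y ^ Suc r * exp (- x * y)) / x)
            \<longlongrightarrow> (real (Suc r) * (fact r / x ^ Suc r) - 0) / x) at_top"
      using assms by (intro tendsto_intros Suc.IH) auto
    also have "(real (Suc r) * (fact r / x ^ Suc r) - 0) / x = fact (Suc r) / x ^ Suc (Suc r)"
      using assms by (simp add: field_simps)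
    finally show ?case
      by (rule Lim_transform_eventually) (use eq in \<open>auto simp: eventually_at_top_linorder intro!: exI[of _ 0]\<close>)
  qed
qed auto

text \<open>Summation by parts rewrites the difference from the limit as \<open>1 - x\<close> times
  the power series of the remainders \<open>D\<close>. Late remainders are small, and the finitely
  many early ones are killed by the factor \<open>1 - x\<close>.\<close>

lemma Abel_limit_at_left_1:
  fixes a :: "nat \<Rightarrow> complex"
  assumes "summable a"
  shows "((\<lambda>x. \<Sum>r. a r * of_real x ^ r) \<longlongrightarrow> suminf a) (at_left 1)"
proof -
  define D where "D = (\<lambda>n. (\<Sum>r\<le>n. a r) - suminf a)"
  have D: "D \<longlonglongrightarrow> 0"
    unfolding D_def using summable_LIMSEQ'[OF assms] by (simp add: LIM_zero)
  then obtain K where K: "\<And>n. norm (D n) \<le> K"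
    by (metis Bseq_def convergent_imp_Bseq convergentI)
  have sumD: "summable (\<lambda>r. D r * of_real x ^ r)" if "0 \<le> x" "x < 1" for x :: real
  proof (rule summable_comparison_test')
    show "summable (\<lambda>r. K * x ^ r)" using that by (intro summable_mult summable_geometric) auto
    show "norm (D r * of_real x ^ r) \<le> K * x ^ r" if "r \<ge> 0" for r
      using K[of r] \<open>0 \<le> x\<close> by (auto simp: norm_mult norm_power intro!: mult_right_mono)
  qed
  \<comment> \<open>Since \<open>a (Suc r) = D (Suc r) - D r\<close>, the series of \<open>a\<close>
    is the series of \<open>D\<close> minus \<open>x\<close> times itself, up to the index 0, where
    \<open>a 0 = D 0 + suminf a\<close>.\<close>
  have eq: "(\<Sum>r. a r * of_real x ^ r) - suminf a = (1 - of_real x) * (\<Sum>r. D r * of_real x ^ r)"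
    if x: "0 \<le> x" "x < 1" for x :: real
  proof -
    let ?x = "complex_of_real x"
    have "(\<lambda>r. D (Suc r) * ?x ^ Suc r) sums ((\<Sum>r. D r * ?x ^ r) - D 0)"
      using summable_sums[OF sumD[OF x]] by (subst sums_Suc_iff) simp
    moreover have "(\<lambda>r. D r * ?x ^ r * ?x) sums ((\<Sum>r. D r * ?x ^ r) * ?x)"
      using summable_sums[OF sumD[OF x]] by (intro sums_mult2)
    ultimately have "(\<lambda>r. D (Suc r) * ?x ^ Suc r - D r * ?x ^ r * ?x) sums
        ((\<Sum>r. D r * ?x ^ r) - D 0 - (\<Sum>r. D r * ?x ^ r) * ?x)"
      by (rule sums_diff)
    also have "(\<lambda>r. D (Suc r) * ?x ^ Suc r - D r * ?x ^ r * ?x) = (\<lambda>r. a (Suc r) * ?x ^ Suc r)"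
      by (simp add: D_def algebra_simps)
    finally have "(\<lambda>r. a r * ?x ^ r) sums
        ((\<Sum>r. D r * ?x ^ r) - D 0 - (\<Sum>r. D r * ?x ^ r) * ?x + a 0 * ?x ^ 0)"
      by (rule sums_Suc)
    thus ?thesis by (simp add: sums_iff D_def algebra_simps)
  qed
  have "((\<lambda>x. (\<Sum>r. a r * of_real x ^ r) - suminf a) \<longlongrightarrow> 0) (at_left 1)"
  proof (rule tendstoI)
    fix e :: real assume e: "e > 0"
    then obtain N where N: "\<And>n. n \<ge> N \<Longrightarrow> norm (D n) < e / 2"
      using LIMSEQ_D[OF D, of "e / 2"] by auto
    define M where "M = (\<Sum>r<N. norm (D r))"
    have "((\<lambda>x. (1 - x) * M) \<longlongrightarrow> (1 - 1) * M) (at_left (1::real))"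
      by (intro tendsto_intros)
    hence "\<forall>\<^sub>F x in at_left 1. (1 - x) * M < e / 2"
      using e by (intro order_tendstoD) auto
    moreover have "\<forall>\<^sub>F x in at_left (1::real). 0 < x \<and> x < 1"
      by (auto simp: eventually_at_left[of 0] intro!: exI[of _ 0])
    ultimately show "\<forall>\<^sub>F x in at_left 1. dist ((\<Sum>r. a r * of_real x ^ r) - suminf a) 0 < e"
    proof eventually_elim
      case (elim x)
      \<comment> \<open>The majorant is geometric from \<open>N\<close> on and uses
        \<open>x ^ r \<le> 1\<close> before \<open>N\<close>; after multiplication by
        \<open>1 - x\<close> the geometric part contributes exactly \<open>e / 2\<close>.\<close>
      have "(\<lambda>r. e / 2 * x ^ r) sums (e / 2 * (1 / (1 - x)))"
        using elim by (intro sums_mult geometric_sums) auto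
      moreover have "(\<lambda>r. if r \<in> {..<N} then norm (D r) else 0) sums M"
        unfolding M_def by (rule sums_If_finite_set) auto
      ultimately have s: "(\<lambda>r. e / 2 * x ^ r + (if r \<in> {..<N} then norm (D r) else 0)) sums
          (e / 2 * (1 / (1 - x)) + M)" by (rule sums_add)
      have "norm (D r * of_real x ^ r) \<le> e / 2 * x ^ r + (if r \<in> {..<N} then norm (D r) else 0)" for r
      proof (cases "r < N")
        case True
        have "norm (D r) * x ^ r \<le> norm (D r) * 1"
          using elim by (intro mult_left_mono power_le_one) auto
        moreover have "0 \<le> e / 2 * x ^ r" using elim e by simp
        ultimately show ?thesis using True elim by (simp add: norm_mult norm_power)
      next
        case False
        thus ?thesis using N[of r] elim by (auto simp: norm_mult norm_power intro!: mult_right_mono)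
      qed
      from norm_suminf_le[OF this sums_summable[OF s]]
      have "norm (\<Sum>r. D r * of_real x ^ r) \<le> e / 2 * (1 / (1 - x)) + M"
        by (simp only: sums_unique[OF s, symmetric])
      hence "(1 - x) * norm (\<Sum>r. D r * of_real x ^ r) \<le> (1 - x) * (e / 2 * (1 / (1 - x)) + M)"
        using elim by (intro mult_left_mono) auto
      also have "\<dots> = e / 2 + (1 - x) * M" using elim by (simp add: field_simps)
      also have "\<dots> < e" using elim by simp
      finally have "norm ((1 - of_real x) * (\<Sum>r. D r * of_real x ^ r)) < e"
        using elim norm_of_real[of "1 - x", where 'a = complex] by (simp add: norm_mult)
      thus ?case using eq[of x] elim by simp
    qed
  qed
  thus ?thesis by (simp add: LIM_zero_iff)
qed

text \<open>For positive \<open>R\<close> the set is the image under \<open>exp\<close> of a convex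
  half-strip; for other \<open>R\<close> the norm condition follows from \<open>Re z > 0\<close>,
  and the whole half-plane remains.\<close>

lemma connected_right_half_annulus: "connected {z. Re z > 0 \<and> norm z > R}"
proof (cases "R > 0")
  case True
  have "{z. Re z > 0 \<and> norm z > R} = exp ` ({z. Re z > ln R} \<inter> {z. Im z < pi / 2} \<inter> {z. Im z > - pi / 2})"
  proof (intro subset_antisym subsetI)
    fix z assume z: "z \<in> {z. Re z > 0 \<and> norm z > R}"
    hence nz: "z \<noteq> 0" by auto
    have "\<bar>Im (Ln z)\<bar> < pi / 2" using z nz Re_Ln_pos_lt by auto
    hence "Ln z \<in> {z. Re z > ln R} \<inter> {z. Im z < pi / 2} \<inter> {z. Im z > - pi / 2}"
      using z nz True by (auto simp: abs_less_iff)
    thus "z \<in> exp ` ({z. Re z > ln R} \<inter> {z. Im z < pi / 2} \<inter> {z. Im z > - pi / 2})"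
      using nz by (metis exp_Ln imageI)
  next
    fix z assume "z \<in> exp ` ({z. Re z > ln R} \<inter> {z. Im z < pi / 2} \<inter> {z. Im z > - pi / 2})"
    then obtain w where "z = exp w" "Re w > ln R" "Im w < pi / 2" "Im w > - pi / 2" by auto
    moreover from this have "R < exp (Re w)" using True by (metis exp_less_mono exp_ln)
    ultimately show "z \<in> {z. Re z > 0 \<and> norm z > R}"
      by (auto simp: Re_exp cos_gt_zero_pi)
  qed
  also have "connected \<dots>"
    by (intro connected_continuous_image continuous_intros convex_connected convex_Int
         convex_halfspace_Re_gt convex_halfspace_Im_lt convex_halfspace_Im_gt)
  finally show ?thesis .
next
  case False
  hence "{z. Re z > 0 \<and> norm z > R} = {z. Re z > 0}"
    by (smt (verit) Collect_cong complex_Re_le_cmod)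
  thus ?thesis by (simp add: convex_connected convex_halfspace_Re_gt)
qed

section \<open>Laplace transforms of entire power series\<close>

lemma norm_coeff_le_power_over_fact:
  fixes u :: "nat \<Rightarrow> complex"
  assumes "summable (\<lambda>r. fact r * u r / s ^ r)" "s \<noteq> 0"
  obtains K where "K \<ge> 0" "\<And>r. norm (u r) \<le> K * (norm s ^ r / fact r)"
proof -
  \<comment> \<open>The terms of a convergent series are bounded, which makes the power series of
    \<open>u\<close> of exponential type at most \<open>norm s\<close>.\<close>
  have "Bseq (\<lambda>r. fact r * u r / s ^ r)"
    using summable_LIMSEQ_zero[OF assms(1)] convergentI convergent_imp_Bseq by blast
  then obtain K where K: "K > 0" "\<And>r. norm (fact r * u r / s ^ r) \<le> K"
    by (auto simp: Bseq_def)
  show ?thesis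
  proof
    show "K \<ge> 0" using K by simp
    show "norm (u r) \<le> K * (norm s ^ r / fact r)" for r
      using K(2)[of r] assms(2) by (simp add: norm_mult norm_divide norm_power field_simps)
  qed
qed

lemma summable_entire:
  fixes u :: "nat \<Rightarrow> complex"
  assumes "\<And>r. norm (u r) \<le> K * (R ^ r / fact r)"
  shows "summable (\<lambda>r. u r * z ^ r)"
proof (rule summable_comparison_test')
  have "(\<lambda>r. K * ((R * norm z) ^ r /\<^sub>R fact r)) sums (K * exp (R * norm z))"
    by (intro sums_mult exp_converges)
  thus "summable (\<lambda>r. K * ((R * norm z) ^ r / fact r))"
    by (simp add: sums_iff divide_inverse mult_ac)
  show "norm (u r * z ^ r) \<le> K * ((R * norm z) ^ r / fact r)" if "r \<ge> 0" for r
    using mult_right_mono[OF assms[of r], of "norm z ^ r"]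
    by (simp add: norm_mult norm_power power_mult_distrib mult_ac)
qed

text \<open>Convergence at \<open>s\<close> makes the transformed series holomorphic where
  \<open>norm z > norm s\<close>, and there the identity is continued from the real axis. The point
  \<open>s\<close> lies on the boundary of that region and is reached along its ray: the left side
  is continuous at \<open>s\<close>, the right side obeys Abel's theorem.\<close>

lemma has_laplace_transform_power_series:
  fixes u :: "nat \<Rightarrow> complex"
  assumes s: "Re s > 0" and sum: "summable (\<lambda>r. fact r * u r / s ^ r)"
    and sub: "subexponential (\<lambda>t. \<Sum>r. u r * of_real t ^ r)"
  shows "has_laplace_transform (\<lambda>t. \<Sum>r. u r * of_real t ^ r) s (1 / s * (\<Sum>r. fact r * u r / s ^ r))"
proof -
  define f where "f = (\<lambda>t. \<Sum>r. u r * complex_of_real t ^ r)"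
  define G where "G = (\<lambda>z. 1 / z * (\<Sum>r. fact r * u r * (1 / z) ^ r))"
  have s0: "s \<noteq> 0" "norm s > 0" using s by auto
  obtain K where K: "K \<ge> 0" "\<And>r. norm (u r) \<le> K * (norm s ^ r / fact r)"
    using norm_coeff_le_power_over_fact[OF sum s0(1)] by blast
  have sumu: "summable (\<lambda>r. u r * z ^ r)" for z
    by (rule summable_entire[OF K(2)])
  have cont: "continuous_on {0..} f"
  proof -
    have "continuous_on UNIV (\<lambda>z. \<Sum>r. u r * z ^ r)"
      using sumu by (intro continuous_at_imp_continuous_on ballI isCont_powser_converges_everywhere) auto
    from continuous_on_compose2[OF this, of "{0..}" complex_of_real] show ?thesis
      unfolding f_def by (auto intro!: continuous_intros)
  qed
  have sub: "subexponential f" unfolding f_def by fact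
  let ?L = "laplace_integral f"
  have sumG: "summable (\<lambda>r. fact r * u r * w ^ r)" if "norm w < 1 / norm s" for w
    by (rule powser_inside[of _ "1 / s"]) (use sum that in \<open>auto simp: power_one_over norm_divide field_simps\<close>)
  \<comment> \<open>For real \<open>x\<close> beyond \<open>norm s\<close> the partial sums are
    dominated by \<open>K * exp (- (x - norm s) * t)\<close>, so termwise integration is
    legitimate.\<close>
  have real_eq: "?L (of_real x) = G (of_real x)" if x: "x > norm s" for x :: real
  proof -
    have x0: "x > 0" using s0 x by linarith
    have "((\<lambda>t. exp (- of_real x * complex_of_real t) * f t) has_integral G (of_real x)) {0..}"
    proof (rule has_integral_dominated_convergence)
      fix k
      have "((\<lambda>t. u r * of_real (t ^ r * exp (- x * t))) has_integral
              u r * of_real (fact r / x ^ Suc r)) {0..}" for r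
        by (intro has_integral_mult_right has_integral_of_real has_integral_power_times_exp x0)
      hence "((\<lambda>t. \<Sum>r<k. u r * of_real (t ^ r * exp (- x * t))) has_integral
              (\<Sum>r<k. u r * of_real (fact r / x ^ Suc r))) {0..}"
        by (intro has_integral_sum) auto
      thus "((\<lambda>t. exp (- of_real x * complex_of_real t) * (\<Sum>r<k. u r * of_real t ^ r)) has_integral
              (\<Sum>r<k. u r * of_real (fact r / x ^ Suc r))) {0..}"
        by (simp add: sum_distrib_left mult_ac flip: exp_of_real)
    next
      show "(\<lambda>t. K * exp (- (x - norm s) * t)) integrable_on {0..}"
        using x by (intro integrable_on_mult_right integrable_on_exp_minus_to_infinity) auto
    next
      fix k
      show "\<forall>t\<in>{0..}. norm (exp (- of_real x * complex_of_real t) * (\<Sum>r<k. u r * of_real t ^ r))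
              \<le> K * exp (- (x - norm s) * t)"
      proof
        fix t :: real assume "t \<in> {0..}"
        hence t: "t \<ge> 0" by simp
        have "norm (\<Sum>r<k. u r * of_real t ^ r) \<le> (\<Sum>r<k. K * ((norm s * t) ^ r / fact r))"
        proof (rule sum_norm_le)
          fix r show "norm (u r * of_real t ^ r) \<le> K * ((norm s * t) ^ r / fact r)"
            using mult_right_mono[OF K(2)[of r], of "t ^ r"] t
            by (simp add: norm_mult norm_power power_mult_distrib mult_ac)
        qed
        also have "\<dots> = K * (\<Sum>r<k. (norm s * t) ^ r /\<^sub>R fact r)"
          by (simp add: sum_distrib_left divide_inverse mult_ac)
        also have "\<dots> \<le> K * exp (norm s * t)"
          using t K(1) exp_converges[of "norm s * t"]
          by (intro mult_left_mono) (auto intro!: sum_le_suminf simp: sums_iff exp_def)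
        finally have "exp (- x * t) * norm (\<Sum>r<k. u r * of_real t ^ r) \<le> exp (- x * t) * (K * exp (norm s * t))"
          by (intro mult_left_mono) auto
        also have "\<dots> = K * exp (- (x - norm s) * t)" by (simp add: algebra_simps flip: exp_add)
        finally show "norm (exp (- of_real x * complex_of_real t) * (\<Sum>r<k. u r * of_real t ^ r))
              \<le> K * exp (- (x - norm s) * t)" by (simp add: norm_mult)
      qed
    next
      show "\<forall>t\<in>{0..}. (\<lambda>k. exp (- of_real x * complex_of_real t) * (\<Sum>r<k. u r * of_real t ^ r))
              \<longlonglongrightarrow> exp (- of_real x * complex_of_real t) * f t"
        unfolding f_def using sumu by (intro ballI tendsto_intros summable_LIMSEQ)
    next
      have "norm (1 / complex_of_real x) < 1 / norm s"
        using x x0 s0 by (simp add: norm_divide frac_less2)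
      hence "(\<lambda>k. 1 / of_real x * (\<Sum>r<k. fact r * u r * (1 / of_real x) ^ r)) \<longlonglongrightarrow> G (of_real x)"
        unfolding G_def by (intro tendsto_intros summable_LIMSEQ sumG)
      also have "(\<lambda>k. 1 / of_real x * (\<Sum>r<k. fact r * u r * (1 / of_real x) ^ r)) =
          (\<lambda>k. \<Sum>r<k. u r * of_real (fact r / x ^ Suc r))"
        using x0 by (simp add: sum_distrib_left field_simps)
      finally show "(\<lambda>k. \<Sum>r<k. u r * of_real (fact r / x ^ Suc r)) \<longlonglongrightarrow> G (of_real x)" .
    qed
    thus ?thesis by (simp add: laplace_integral_def integral_unique)
  qed
  \<comment> \<open>On \<open>S\<close> the point \<open>1 / z\<close> lies in an open disc on which
    the series in \<open>G\<close> converges.\<close>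
  define S where "S = {z. Re z > 0 \<and> norm z > norm s}"
  have holL: "?L holomorphic_on {z. Re z > 0}"
    by (rule laplace_integral_holomorphic[OF cont sub])
  have eq: "?L z - G z = 0" if "z \<in> S" for z
  proof (rule analytic_continuation[where S = S and f = "\<lambda>z. ?L z - G z"])
    have "(\<lambda>w. \<Sum>r. fact r * u r * w ^ r) holomorphic_on ball 0 (1 / norm s)"
      by (rule power_series_holomorphic[where a = "\<lambda>r. fact r * u r"]) (auto intro!: summable_sums sumG)
    hence "(\<lambda>w. \<Sum>r. fact r * u r * w ^ r) \<circ> (\<lambda>z. 1 / z) holomorphic_on S"
    proof (rule holomorphic_on_compose_gen[rotated])
      show "(\<lambda>z. 1 / z) holomorphic_on S" by (intro holomorphic_intros) (auto simp: S_def)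
      show "(\<lambda>z. 1 / z) ` S \<subseteq> ball 0 (1 / norm s)"
        using s0 by (auto simp: S_def norm_divide frac_less2)
    qed
    hence "G holomorphic_on S"
      unfolding G_def o_def by (intro holomorphic_intros) (auto simp: S_def)
    moreover have "?L holomorphic_on S"
      by (rule holomorphic_on_subset[OF holL]) (auto simp: S_def)
    ultimately show "(\<lambda>z. ?L z - G z) holomorphic_on S" by (rule holomorphic_on_diff[rotated])
    have "S = {z. Re z > 0} \<inter> {z. norm z > norm s}" by (auto simp: S_def)
    also have "open \<dots>"
      by (intro open_Int open_halfspace_Re_gt open_Collect_less continuous_intros)
    finally show "open S" .
    show "connected S" unfolding S_def by (rule connected_right_half_annulus)
    \<comment> \<open>The identity is known on this ray, which accumulates at its point
      \<open>norm s + 1\<close>.\<close>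
    let ?U = "complex_of_real ` {norm s<..}"
    show "?U \<subseteq> S" by (auto simp: S_def) (use s0 in linarith)+
    show "complex_of_real (norm s + 1) \<in> S" using s0 by (auto simp: S_def intro: add_pos_pos)
    show "?L z - G z = 0" if "z \<in> ?U" for z using that real_eq by auto
    show "complex_of_real (norm s + 1) islimpt ?U"
      unfolding islimpt_approachable
    proof (intro allI impI)
      fix e :: real assume "e > 0"
      thus "\<exists>z\<in>?U. z \<noteq> complex_of_real (norm s + 1) \<and> dist z (complex_of_real (norm s + 1)) < e"
        by (intro bexI[of _ "complex_of_real (norm s + 1 + e / 2)"])
           (auto simp: dist_norm simp flip: of_real_add of_real_diff)
    qed
    show "z \<in> S" by fact
  qed
  have ev: "\<forall>\<^sub>F y in at_left (1::real). 0 < y \<and> y < 1"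
    by (auto simp: eventually_at_left[of 0] intro!: exI[of _ 0])
  \<comment> \<open>Replacing \<open>s\<close> by \<open>s / y\<close> multiplies the term of index
    \<open>r\<close> by \<open>y ^ r\<close> and the prefactor \<open>1 / s\<close> by
    \<open>y\<close>, so the series turns into its own Abel mean.\<close>
  have "((\<lambda>y. of_real y * (1 / s) * (\<Sum>r. fact r * u r / s ^ r * of_real y ^ r)) \<longlongrightarrow>
          of_real 1 * (1 / s) * (\<Sum>r. fact r * u r / s ^ r)) (at_left 1)"
    by (intro tendsto_intros Abel_limit_at_left_1 sum)
  moreover have "\<forall>\<^sub>F y in at_left (1::real).
     of_real y * (1 / s) * (\<Sum>r. fact r * u r / s ^ r * of_real y ^ r) = ?L (s / of_real y)"
    using ev
  proof eventually_elim
    case (elim y)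
    have "s / of_real y \<in> S"
      using elim s s0 by (auto simp: S_def norm_divide field_simps Re_divide_of_real)
    with eq have "?L (s / of_real y) = G (s / of_real y)" by simp
    thus ?case using elim s0 by (simp add: G_def power_divide field_simps)
  qed
  ultimately have 1: "((\<lambda>y. ?L (s / of_real y)) \<longlongrightarrow> 1 / s * (\<Sum>r. fact r * u r / s ^ r)) (at_left 1)"
    by (auto dest: Lim_transform_eventually)
  have "isCont ?L s"
    using holomorphic_on_imp_continuous_on[OF holL] s
    by (simp add: continuous_on_eq_continuous_at open_halfspace_Re_gt)
  moreover have "((\<lambda>y. s / of_real y) \<longlongrightarrow> s / of_real 1) (at_left (1::real))"
    by (intro tendsto_intros) auto
  ultimately have 2: "((\<lambda>y. ?L (s / of_real y)) \<longlongrightarrow> ?L s) (at_left (1::real))"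
    using isCont_tendsto_compose by fastforce
  have "?L s = 1 / s * (\<Sum>r. fact r * u r / s ^ r)"
    using tendsto_unique[OF _ 2 1] by simp
  with has_laplace_transform_laplace_integral[OF cont sub s] show ?thesis
    unfolding f_def by simp
qed

section \<open>Moments of the Beta kernel\<close>

lemma vanishing_moments_imp_zero_real:
  fixes h :: "real \<Rightarrow> real"
  assumes cont: "continuous_on {0..1} h" and mom: "\<And>r. ((\<lambda>x. x ^ r * h x) has_integral 0) {0..1}"
  shows "\<forall>x\<in>{0..1}. h x = 0"
proof -
  define M where "M = integral {0..1} (\<lambda>x. \<bar>h x\<bar>)"
  have M: "M \<ge> 0" unfolding M_def by (intro integral_nonneg integrable_continuous_interval continuous_intros cont) auto
  \<comment> \<open>Orthogonality to polynomials lets \<open>h * h\<close> be replaced by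
    \<open>(h - p) * h\<close> for a Weierstrass approximation \<open>p\<close>, so the integral of
    \<open>h * h\<close> is arbitrarily small. The denominator \<open>M + 1\<close> in
    \<open>d\<close> allows for \<open>M = 0\<close>.\<close>
  have "integral {0..1} (\<lambda>x. h x * h x) \<le> 0 + e" if "e > 0" for e
  proof -
    define d where "d = e / (M + 1)"
    have d: "d > 0" "d * M \<le> e" using M that by (auto simp: d_def field_simps)
    obtain p where p: "real_polynomial_function p" "\<And>x. x \<in> {0..1} \<Longrightarrow> \<bar>h x - p x\<bar> < d"
      using Stone_Weierstrass_real_polynomial_function[OF _ cont d(1)] by auto
    then obtain a n where a: "p = (\<lambda>x. \<Sum>i\<le>n. a i * x ^ i)"
      using real_polynomial_function_imp_sum by blast
    have "((\<lambda>x. \<Sum>i\<le>n. a i * (x ^ i * h x)) has_integral (\<Sum>i\<le>n. a i * 0)) {0..1}"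
      by (intro has_integral_sum has_integral_mult_right mom) auto
    hence "((\<lambda>x. p x * h x) has_integral 0) {0..1}"
      by (simp add: a sum_distrib_left sum_distrib_right mult_ac)
    moreover have "((\<lambda>x. h x * h x) has_integral integral {0..1} (\<lambda>x. h x * h x)) {0..1}"
      by (intro integrable_integral integrable_continuous_interval continuous_intros cont)
    ultimately have "((\<lambda>x. h x * h x - p x * h x) has_integral
        (integral {0..1} (\<lambda>x. h x * h x) - 0)) {0..1}"
      by (intro has_integral_diff)
    moreover have "((\<lambda>x. d * \<bar>h x\<bar>) has_integral d * M) {0..1}"
      unfolding M_def
      by (intro has_integral_mult_right integrable_integral integrable_continuous_interval continuous_intros cont)
    ultimately have "integral {0..1} (\<lambda>x. h x * h x) - 0 \<le> d * M"
    proof (rule has_integral_le)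
      fix x :: real assume x: "x \<in> {0..1}"
      have "h x * h x - p x * h x \<le> \<bar>h x - p x\<bar> * \<bar>h x\<bar>"
        by (metis abs_ge_self abs_mult left_diff_distrib)
      also have "\<dots> \<le> d * \<bar>h x\<bar>" using p(2)[OF x] by (intro mult_right_mono) auto
      finally show "h x * h x - p x * h x \<le> d * \<bar>h x\<bar>" .
    qed
    thus ?thesis using d by simp
  qed
  hence "integral {0..1} (\<lambda>x. h x * h x) \<le> 0" by (rule field_le_epsilon)
  moreover have "integral {0..1} (\<lambda>x. h x * h x) \<ge> 0"
    by (intro integral_nonneg integrable_continuous_interval continuous_intros cont) auto
  ultimately have "integral {0..1} (\<lambda>x. h x * h x) = 0" by simp
  thus ?thesis
    by (subst (asm) integral_eq_0_iff) (auto intro!: continuous_intros cont)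
qed

lemma vanishing_moments_imp_zero:
  fixes g :: "real \<Rightarrow> complex"
  assumes cont: "continuous_on {0..1} g"
    and mom: "\<And>r. ((\<lambda>x. of_real x ^ r * g x) has_integral 0) {0..1}"
  shows "\<forall>x\<in>{0..1}. g x = 0"
proof -
  have "((\<lambda>x. x ^ r * Re (g x)) has_integral 0) {0..1}" for r
    using has_integral_linear[OF mom[of r] bounded_linear_Re] by (simp add: o_def flip: of_real_power)
  hence "\<forall>x\<in>{0..1}. Re (g x) = 0"
    by (intro vanishing_moments_imp_zero_real continuous_intros cont)
  moreover have "((\<lambda>x. x ^ r * Im (g x)) has_integral 0) {0..1}" for r
    using has_integral_linear[OF mom[of r] bounded_linear_Im] by (simp add: o_def flip: of_real_power)
  hence "\<forall>x\<in>{0..1}. Im (g x) = 0"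
    by (intro vanishing_moments_imp_zero_real continuous_intros cont)
  ultimately show ?thesis by (simp add: complex_eq_iff)
qed

section \<open>Euler's Beta integrand with complex parameters, and its moments\<close>

definition beta_kernel :: "complex \<Rightarrow> complex \<Rightarrow> real \<Rightarrow> complex" where
  "beta_kernel a c x = of_real x powr (a - 1) * of_real (1 - x) powr (c - 1)"

text \<open>In absolute value the function is at most the real Beta integrand with parameters
  \<open>Re a\<close> and \<open>Re c\<close>, because \<open>x ^ r \<le> 1\<close>.\<close>

lemma beta_kernel_abs_integrable:
  assumes "Re a > 0" "Re c > 0"
  shows "(\<lambda>x. of_real x ^ r * beta_kernel a c x) absolutely_integrable_on {0<..<1}"
proof (rule measurable_bounded_by_integrable_imp_absolutely_integrable)
  show "(\<lambda>x. of_real x ^ r * beta_kernel a c x) \<in> borel_measurable (lebesgue_on {0<..<1})"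
    unfolding beta_kernel_def
    by (intro continuous_imp_measurable_on_sets_lebesgue continuous_intros) auto
  show "(\<lambda>x. x powr (Re a - 1) * (1 - x) powr (Re c - 1)) integrable_on {0<..<1::real}"
    using integrable_Beta'[OF assms] by (simp add: integrable_on_Icc_iff_Ioo)
  fix x :: real assume "x \<in> {0<..<1}"
  hence x: "0 < x" "x < 1" by auto
  have "norm (of_real x ^ r * beta_kernel a c x) = x ^ r * (x powr (Re a - 1) * (1 - x) powr (Re c - 1))"
    using x by (simp add: beta_kernel_def norm_mult norm_power norm_powr_real_powr del: of_real_diff)
  also have "\<dots> \<le> 1 * (x powr (Re a - 1) * (1 - x) powr (Re c - 1))"
    using x by (intro mult_right_mono power_le_one) auto
  finally show "norm (of_real x ^ r * beta_kernel a c x) \<le> x powr (Re a - 1) * (1 - x) powr (Re c - 1)"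
    by simp
qed auto

text \<open>The difference of the two sides is the integral of the derivative of \<open>F\<close>,
  that is, of x^(a+r) (1-x)^c, which is continuous on the closed interval and vanishes at both end
  points.\<close>

lemma beta_kernel_moment_rec:
  assumes "Re a > 0" "Re c > 0"
  shows "(a + of_nat r) * integral {0<..<1} (\<lambda>x. of_real x ^ r * beta_kernel a c x) =
         (a + c + of_nat r) * integral {0<..<1} (\<lambda>x. of_real x ^ Suc r * beta_kernel a c x)"
proof -
  define F where "F = (\<lambda>z::complex. z powr a * z ^ r * (1 - z) powr c)"
  have "((\<lambda>x. (a + of_nat r) * (of_real x ^ r * beta_kernel a c x) -
               (a + c + of_nat r) * (of_real x ^ Suc r * beta_kernel a c x)) has_integral
         (F (of_real 1) - F (of_real 0))) {0..1}"
  \<comment> \<open>Only continuity is available at the end points, where the derivative may blow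
    up.\<close>
  proof (rule fundamental_theorem_of_calculus_interior)
    show "continuous_on {0..1::real} (\<lambda>x. F (of_real x))"
      unfolding F_def using assms by (intro continuous_intros) auto
    fix x :: real assume x: "x \<in> {0<..<1}"
    define z where "z = complex_of_real x"
    have z: "z \<notin> \<real>\<^sub>\<le>\<^sub>0" "1 - z \<notin> \<real>\<^sub>\<le>\<^sub>0" "z \<noteq> 0" "1 - z \<noteq> 0"
      using x by (auto simp: z_def complex_nonpos_Reals_iff)
    have pa: "z powr a = z * z powr (a - 1)" and pc: "(1 - z) powr c = (1 - z) * (1 - z) powr (c - 1)"
      using z by (auto simp: powr_diff)
    have pr: "z * (of_nat r * z ^ (r - Suc 0)) = of_nat r * z ^ r"
      by (cases r) auto
    have "(F has_field_derivative
        ((a * z powr (a - 1)) * z ^ r + z powr a * (of_nat r * z ^ (r - Suc 0))) * (1 - z) powr c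
           - z powr a * z ^ r * (c * (1 - z) powr (c - 1))) (at z)"
      unfolding F_def using z by (auto intro!: derivative_eq_intros simp: algebra_simps)
    also have "((a * z powr (a - 1)) * z ^ r + z powr a * (of_nat r * z ^ (r - Suc 0))) * (1 - z) powr c
           - z powr a * z ^ r * (c * (1 - z) powr (c - 1)) =
         ((a * z ^ r + z * (of_nat r * z ^ (r - Suc 0))) * (1 - z) - c * z ^ Suc r) *
           (z powr (a - 1) * (1 - z) powr (c - 1))"
      unfolding pa pc by (simp add: algebra_simps)
    also have "\<dots> = (a + of_nat r) * (z ^ r * beta_kernel a c x) -
               (a + c + of_nat r) * (z ^ Suc r * beta_kernel a c x)"
      unfolding pr by (simp add: beta_kernel_def z_def algebra_simps)
    finally show "((\<lambda>x. F (of_real x)) has_vector_derivative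
        (a + of_nat r) * (of_real x ^ r * beta_kernel a c x) -
               (a + c + of_nat r) * (of_real x ^ Suc r * beta_kernel a c x)) (at x)"
      unfolding z_def by (rule has_vector_derivative_real_field)
  qed simp
  also have "F (of_real 1) - F (of_real 0) = 0" by (simp add: F_def)
  finally have "((\<lambda>x. (a + of_nat r) * (of_real x ^ r * beta_kernel a c x) -
               (a + c + of_nat r) * (of_real x ^ Suc r * beta_kernel a c x)) has_integral 0) {0<..<1}"
    by (simp add: has_integral_Icc_iff_Ioo)
  moreover have "((\<lambda>x. (a + of_nat r) * (of_real x ^ r * beta_kernel a c x) -
               (a + c + of_nat r) * (of_real x ^ Suc r * beta_kernel a c x)) has_integral
       ((a + of_nat r) * integral {0<..<1} (\<lambda>x. of_real x ^ r * beta_kernel a c x) -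
         (a + c + of_nat r) * integral {0<..<1} (\<lambda>x. of_real x ^ Suc r * beta_kernel a c x))) {0<..<1}"
    by (intro has_integral_diff has_integral_mult_right integrable_integral
          set_lebesgue_integral_eq_integral(1) beta_kernel_abs_integrable assms)
  ultimately show ?thesis
    by (auto dest: has_integral_unique)
qed

text \<open>Iterating the recurrence produces the quotient; the total mass, Euler's B(a,c), is left
  unevaluated.\<close>

lemma beta_kernel_moment:
  assumes "Re a > 0" "Re c > 0"
  shows "integral {0<..<1} (\<lambda>x. of_real x ^ r * beta_kernel a c x) =
         integral {0<..<1} (beta_kernel a c) * (pochhammer a r / pochhammer (a + c) r)"
proof (induction r)
  case (Suc r)
  have "Re (a + c + of_nat r) > 0" using assms by simp
  hence nz: "a + c + of_nat r \<noteq> 0" by (metis less_irrefl zero_complex.sel(1))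
  have "integral {0<..<1} (\<lambda>x. of_real x ^ Suc r * beta_kernel a c x) =
      (a + of_nat r) / (a + c + of_nat r) * integral {0<..<1} (\<lambda>x. of_real x ^ r * beta_kernel a c x)"
    using beta_kernel_moment_rec[OF assms, of r] nz by (simp add: field_simps)
  thus ?case unfolding Suc.IH by (simp add: pochhammer_Suc mult_ac)
qed auto

text \<open>If the mass vanished, so would all moments. Multiplying the kernel by
  \<open>x * (1 - x)\<close> gives a function \<open>g\<close>, continuous on the closed interval,
  whose moments are differences of kernel moments. It would be identically zero, yet it is nonzero
  at \<open>1 / 2\<close>.\<close>

lemma integral_beta_kernel_nonzero:
  assumes "Re a > 0" "Re c > 0"
  shows "integral {0<..<1} (beta_kernel a c) \<noteq> 0"
proof
  assume zero: "integral {0<..<1} (beta_kernel a c) = 0"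
  define g where "g = (\<lambda>x. complex_of_real x powr a * of_real (1 - x) powr c)"
  have mom: "((\<lambda>x. of_real x ^ r * beta_kernel a c x) has_integral 0) {0<..<1}" for r
    using beta_kernel_moment[OF assms, of r] zero beta_kernel_abs_integrable[OF assms, of r]
    by (metis integrable_integral mult_zero_left set_lebesgue_integral_eq_integral(1))
  have "\<forall>x\<in>{0..1}. g x = 0"
  proof (rule vanishing_moments_imp_zero)
    show "continuous_on {0..1} g"
      unfolding g_def using assms by (intro continuous_intros) auto
    fix r
    have "((\<lambda>x. of_real x ^ Suc r * beta_kernel a c x - of_real x ^ Suc (Suc r) * beta_kernel a c x)
             has_integral 0 - 0) {0<..<1}"
      by (intro has_integral_diff mom)
    hence "((\<lambda>x. of_real x ^ r * g x) has_integral 0 - 0) {0<..<1}"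
    proof (rule has_integral_eq[rotated])
      fix x :: real assume x: "x \<in> {0<..<1}"
      hence *: "complex_of_real x powr a = of_real x * of_real x powr (a - 1)"
        "(1 - complex_of_real x) powr c = (1 - of_real x) * (1 - of_real x) powr (c - 1)"
        by (auto simp: powr_diff)
      show "of_real x ^ Suc r * beta_kernel a c x - of_real x ^ Suc (Suc r) * beta_kernel a c x =
            of_real x ^ r * g x"
        unfolding g_def beta_kernel_def of_real_diff of_real_1 * by (simp add: algebra_simps)
    qed
    thus "((\<lambda>x. of_real x ^ r * g x) has_integral 0) {0..1}"
      by (simp add: has_integral_Icc_iff_Ioo)
  qed
  hence "g (1 / 2) = 0" by (rule bspec) auto
  thus False by (simp add: g_def)
qed

text \<open>The kernel is the Beta kernel with second parameter \<open>b - a\<close>, divided by its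
  mass.\<close>

lemma pochhammer_quotient_moments:
  assumes "Re a > 0" "Re b > Re a"
  obtains k where "\<And>r. (\<lambda>x. of_real x ^ r * k x) absolutely_integrable_on {0<..<1}"
    "\<And>r. ((\<lambda>x. of_real x ^ r * k x) has_integral (pochhammer a r / pochhammer b r)) {0<..<1}"
proof -
  define c where "c = b - a"
  have c: "Re c > 0" "b = a + c" using assms by (auto simp: c_def)
  define I where "I = integral {0<..<1} (beta_kernel a c)"
  have I: "I \<noteq> 0" unfolding I_def by (rule integral_beta_kernel_nonzero[OF assms(1) c(1)])
  note abs = beta_kernel_abs_integrable[OF assms(1) c(1)]
  show ?thesis
  proof
    fix r
    show "(\<lambda>x. of_real x ^ r * (1 / I * beta_kernel a c x)) absolutely_integrable_on {0<..<1}"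
      using set_integrable_mult_right[OF abs[of r], of "1 / I"] by (simp add: mult_ac)
    have "((\<lambda>x. 1 / I * (of_real x ^ r * beta_kernel a c x)) has_integral
            (1 / I * (I * (pochhammer a r / pochhammer b r)))) {0<..<1}"
      unfolding c(2) I_def beta_kernel_moment[OF assms(1) c(1), symmetric]
      by (intro has_integral_mult_right integrable_integral set_lebesgue_integral_eq_integral(1) abs)
    thus "((\<lambda>x. of_real x ^ r * (1 / I * beta_kernel a c x)) has_integral
            (pochhammer a r / pochhammer b r)) {0<..<1}"
      using I by (simp add: mult_ac)
  qed
qed

section \<open>Coefficient multipliers preserving subexponential growth\<close>

text \<open>Weighting by \<open>r ^ j\<close> amounts to applying \<open>(t d/dt)\<^sup>j\<close> to the power series; it commutes
  with all coefficient multipliers, which is what makes this class closed under them.\<close>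

definition tame_coeffs :: "(nat \<Rightarrow> complex) \<Rightarrow> bool" where
  "tame_coeffs u \<longleftrightarrow> (\<forall>j. (\<forall>t. summable (\<lambda>r. of_nat r ^ j * u r * complex_of_real t ^ r)) \<and>
     subexponential (\<lambda>t. \<Sum>r. of_nat r ^ j * u r * complex_of_real t ^ r))"

lemma tame_coeffsD:
  assumes "tame_coeffs u"
  shows "summable (\<lambda>r. of_nat r ^ j * u r * complex_of_real t ^ r)"
    and "subexponential (\<lambda>t. \<Sum>r. of_nat r ^ j * u r * complex_of_real t ^ r)"
  using assms unfolding tame_coeffs_def by blast+

text \<open>The factor \<open>of_nat r\<close> merely raises the weight exponent \<open>j\<close> by
  one.\<close>

lemma tame_coeffs_linear_factor:
  assumes "tame_coeffs u"
  shows "tame_coeffs (\<lambda>r. (c + of_nat r) * u r)"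
  unfolding tame_coeffs_def
proof (intro allI conjI)
  fix j
  have sums: "(\<lambda>r. of_nat r ^ j * ((c + of_nat r) * u r) * complex_of_real t ^ r) sums
      (c * (\<Sum>r. of_nat r ^ j * u r * complex_of_real t ^ r) +
        (\<Sum>r. of_nat r ^ Suc j * u r * complex_of_real t ^ r))" for t
  proof -
    have "(\<lambda>r. c * (of_nat r ^ j * u r * complex_of_real t ^ r) +
              of_nat r ^ Suc j * u r * complex_of_real t ^ r) sums
      (c * (\<Sum>r. of_nat r ^ j * u r * complex_of_real t ^ r) +
        (\<Sum>r. of_nat r ^ Suc j * u r * complex_of_real t ^ r))"
      by (intro sums_add sums_mult summable_sums tame_coeffsD assms)
    thus ?thesis by (simp add: algebra_simps)
  qed
  show "summable (\<lambda>r. of_nat r ^ j * ((c + of_nat r) * u r) * complex_of_real t ^ r)" for t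
    using sums[of t] by (rule sums_summable)
  show "subexponential (\<lambda>t. \<Sum>r. of_nat r ^ j * ((c + of_nat r) * u r) * complex_of_real t ^ r)"
    unfolding sums[THEN sums_unique, symmetric]
    by (intro subexponential_intros tame_coeffsD assms)
qed

lemma tame_coeffs_cmult:
  assumes "tame_coeffs u"
  shows "tame_coeffs (\<lambda>r. c * u r)"
  unfolding tame_coeffs_def
proof (intro allI conjI)
  fix j
  have sums: "(\<lambda>r. of_nat r ^ j * (c * u r) * complex_of_real t ^ r) sums
      (c * (\<Sum>r. of_nat r ^ j * u r * complex_of_real t ^ r))" for t
    using sums_mult[OF summable_sums[OF tame_coeffsD(1)[OF assms, of j t]], of c]
    by (simp add: mult_ac)
  show "summable (\<lambda>r. of_nat r ^ j * (c * u r) * complex_of_real t ^ r)" for t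
    using sums[of t] by (rule sums_summable)
  show "subexponential (\<lambda>t. \<Sum>r. of_nat r ^ j * (c * u r) * complex_of_real t ^ r)"
    unfolding sums[THEN sums_unique, symmetric]
    by (intro subexponential_intros tame_coeffsD assms)
qed

text \<open>Induction on \<open>j\<close>. For \<open>j = 0\<close> the sum is
  \<open>exp (q * t)\<close>, bounded for \<open>t \<ge> 0\<close>. For \<open>j = i + 1\<close> one
  factor of \<open>(r + 1) ^ j\<close> cancels against the factorial at the shifted index, and the
  binomial expansion of \<open>(r + 1) ^ i\<close> leaves sums of weight at most \<open>i\<close>,
  multiplied by \<open>q * t\<close>.\<close>

lemma tame_coeffs_exp:
  assumes "Re q \<le> 0"
  shows "tame_coeffs (\<lambda>r. q ^ r / fact r)"
proof -
  define T where "T = (\<lambda>j t r. of_nat r ^ j * (q ^ r / fact r) * complex_of_real t ^ r)"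
  have "(\<forall>t. summable (T j t)) \<and> subexponential (\<lambda>t. \<Sum>r. T j t r)" for j
  proof (induction j rule: less_induct)
    case (less j)
    show ?case
    proof (cases j)
      case 0
      have sums: "T 0 t sums exp (q * of_real t)" for t
        using exp_converges[of "q * of_real t"]
        by (simp add: T_def power_mult_distrib scaleR_conv_of_real field_simps)
      have "subexponential (\<lambda>t. exp (q * of_real t))"
        unfolding subexponential_def
      proof (intro allI impI exI)
        fix \<epsilon> t :: real assume "\<epsilon> > 0" "t \<ge> 0"
        hence "Re (q * of_real t) \<le> \<epsilon> * t"
          using assms by (simp add: mult_nonpos_nonneg order_trans[of _ 0])
        thus "norm (exp (q * of_real t)) \<le> 1 * exp (\<epsilon> * t)" by simp
      qed
      thus ?thesis
        unfolding 0 sums[THEN sums_unique, symmetric] using sums by (blast intro: sums_summable)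
    next
      case (Suc i)
      have IH: "summable (T k t)" "subexponential (\<lambda>t. \<Sum>r. T k t r)" if "k \<le> i" for k t
        using less.IH[of k] that Suc by auto
      have sums: "T j t sums (q * of_real t * (\<Sum>k\<le>i. of_nat (i choose k) * (\<Sum>r. T k t r)))" for t
      proof -
        have eq: "T j t (Suc r) = q * of_real t * (\<Sum>k\<le>i. of_nat (i choose k) * T k t r)" for r
        proof -
          have "T j t (Suc r) = (of_nat r + 1) ^ i * (q ^ Suc r / fact r * of_real t ^ Suc r)"
            by (simp add: T_def Suc field_simps del: of_nat_Suc) (simp add: algebra_simps)
          also have "(of_nat r + 1 :: complex) ^ i = (\<Sum>k\<le>i. of_nat (i choose k) * of_nat r ^ k)"
            by (subst binomial_ring) simp
          finally show ?thesis
            by (simp add: T_def sum_distrib_left sum_distrib_right sum_divide_distrib mult_ac)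
        qed
        have "(\<lambda>r. q * of_real t * (\<Sum>k\<le>i. of_nat (i choose k) * T k t r)) sums
            (q * of_real t * (\<Sum>k\<le>i. of_nat (i choose k) * (\<Sum>r. T k t r)))"
          by (intro sums_mult sums_sum summable_sums IH) auto
        hence "(\<lambda>r. T j t (Suc r)) sums
            (q * of_real t * (\<Sum>k\<le>i. of_nat (i choose k) * (\<Sum>r. T k t r)))"
          unfolding eq .
        \<comment> \<open>The term at index 0 vanishes because the weight exponent is
          positive.\<close>
        from sums_Suc[OF this] show ?thesis by (simp add: T_def Suc)
      qed
      have "subexponential (\<lambda>t. q * of_real t * (\<Sum>k\<le>i. of_nat (i choose k) * (\<Sum>r. T k t r)))"
        by (intro subexponential_intros IH) auto
      thus ?thesis
        unfolding sums[THEN sums_unique, symmetric] using sums by (blast intro: sums_summable)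
    qed
  qed
  thus ?thesis unfolding tame_coeffs_def T_def by blast
qed

text \<open>Multiplying coefficients by moments of \<open>k\<close> averages the function: the new
  series at \<open>t\<close> is the integral of \<open>k x\<close> times the old series at
  \<open>x * t\<close>. Since \<open>x * t \<le> t\<close> for \<open>t \<ge> 0\<close>, an
  exponential bound survives, its constant multiplied by the integral of
  \<open>norm (k x)\<close>.\<close>

lemma tame_coeffs_moments:
  assumes u: "tame_coeffs u"
    and k: "\<And>r. (\<lambda>x. of_real x ^ r * k x) absolutely_integrable_on {0<..<1}"
    and w: "\<And>r. ((\<lambda>x. of_real x ^ r * k x) has_integral w r) {0<..<1}"
  shows "tame_coeffs (\<lambda>r. w r * u r)"
  unfolding tame_coeffs_def
proof (intro allI conjI)
  fix j
  define v where "v = (\<lambda>r. of_nat r ^ j * u r)"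
  define B where "B = integral {0<..<1} (\<lambda>x. norm (k x))"
  have kn: "(\<lambda>x. norm (k x)) integrable_on {0<..<1}"
    using k[of 0] by (simp add: absolutely_integrable_on_def)
  have wB: "norm (w r) \<le> B" for r
  proof -
    have "norm (integral {0<..<1} (\<lambda>x. of_real x ^ r * k x)) \<le> B"
      unfolding B_def
    proof (intro integral_norm_bound_integral kn has_integral_integrable[OF w])
      fix x :: real assume "x \<in> {0<..<1}"
      thus "norm (of_real x ^ r * k x) \<le> norm (k x)"
        by (simp add: norm_mult norm_power mult_left_le_one_le power_le_one)
    qed
    thus ?thesis using integral_unique[OF w[of r]] by simp
  qed
  \<comment> \<open>Convergence at the larger point \<open>\<bar>t\<bar> + 1\<close> yields absolute
    convergence at \<open>t\<close>.\<close>
  have v: "summable (\<lambda>r. norm (v r * of_real t ^ r))" for t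
  proof (rule powser_insidea)
    show "summable (\<lambda>r. v r * complex_of_real (\<bar>t\<bar> + 1) ^ r)"
      unfolding v_def by (rule tame_coeffsD[OF u])
    have "norm (complex_of_real (\<bar>t\<bar> + 1)) = \<bar>t\<bar> + 1" by (subst norm_of_real) simp
    thus "norm (complex_of_real t) < norm (complex_of_real (\<bar>t\<bar> + 1))" by simp
  qed
  have sum: "summable (\<lambda>r. w r * (v r * of_real t ^ r))" for t
  proof (rule summable_comparison_test')
    show "summable (\<lambda>r. B * norm (v r * of_real t ^ r))" by (intro summable_mult v)
    show "norm (w r * (v r * of_real t ^ r)) \<le> B * norm (v r * of_real t ^ r)" for r
      unfolding norm_mult[of "w r"] by (intro mult_right_mono wB) auto
  qed
  thus "summable (\<lambda>r. of_nat r ^ j * (w r * u r) * complex_of_real t ^ r)" for t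
    by (simp add: v_def mult_ac)
  have int: "((\<lambda>x. k x * (\<Sum>r. v r * of_real (x * t) ^ r)) has_integral
      (\<Sum>r. w r * (v r * of_real t ^ r))) {0<..<1}" for t
  proof (rule has_integral_dominated_convergence)
    fix n
    have "((\<lambda>x. \<Sum>r<n. (of_real x ^ r * k x) * (v r * of_real t ^ r)) has_integral
       (\<Sum>r<n. w r * (v r * of_real t ^ r))) {0<..<1}"
      by (intro has_integral_sum has_integral_mult_left w) auto
    thus "((\<lambda>x. k x * (\<Sum>r<n. v r * of_real (x * t) ^ r)) has_integral
       (\<Sum>r<n. w r * (v r * of_real t ^ r))) {0<..<1}"
      by (simp add: sum_distrib_left power_mult_distrib mult_ac)
  next
    define M where "M = (\<Sum>r. norm (v r * of_real t ^ r))"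
    show "(\<lambda>x. norm (k x) * M) integrable_on {0<..<1}" by (intro integrable_on_mult_left kn)
    show "\<forall>x\<in>{0<..<1}. norm (k x * (\<Sum>r<n. v r * of_real (x * t) ^ r)) \<le> norm (k x) * M" for n
    proof
      fix x :: real assume x: "x \<in> {0<..<1}"
      have "norm (\<Sum>r<n. v r * of_real (x * t) ^ r) \<le> (\<Sum>r<n. norm (v r * of_real t ^ r))"
      proof (rule sum_norm_le)
        fix r
        have "norm (v r * of_real (x * t) ^ r) = x ^ r * norm (v r * of_real t ^ r)"
          using x by (simp add: norm_mult norm_power power_mult_distrib)
        also have "\<dots> \<le> 1 * norm (v r * of_real t ^ r)"
          using x by (intro mult_right_mono power_le_one) auto
        finally show "norm (v r * of_real (x * t) ^ r) \<le> norm (v r * of_real t ^ r)" by simp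
      qed
      also have "\<dots> \<le> M" unfolding M_def by (intro sum_le_suminf v) auto
      finally show "norm (k x * (\<Sum>r<n. v r * of_real (x * t) ^ r)) \<le> norm (k x) * M"
        unfolding norm_mult by (intro mult_left_mono) auto
    qed
  next
    show "\<forall>x\<in>{0<..<1}. (\<lambda>n. k x * (\<Sum>r<n. v r * of_real (x * t) ^ r)) \<longlonglongrightarrow>
        k x * (\<Sum>r. v r * of_real (x * t) ^ r)"
      by (intro ballI tendsto_mult tendsto_const summable_LIMSEQ summable_norm_cancel[OF v])
    show "(\<lambda>n. \<Sum>r<n. w r * (v r * of_real t ^ r)) \<longlonglongrightarrow> (\<Sum>r. w r * (v r * of_real t ^ r))"
      by (intro summable_LIMSEQ sum)
  qed
  have "subexponential (\<lambda>t. \<Sum>r. w r * (v r * of_real t ^ r))"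
    unfolding subexponential_def
  proof (intro allI impI)
    fix \<epsilon> :: real assume \<epsilon>: "\<epsilon> > 0"
    obtain C where C: "C \<ge> 0" "\<And>t. t \<ge> 0 \<Longrightarrow> norm (\<Sum>r. v r * of_real t ^ r) \<le> C * exp (\<epsilon> * t)"
      unfolding v_def using subexponentialE[OF tame_coeffsD(2)[OF u] \<epsilon>] by blast
    have "norm (\<Sum>r. w r * (v r * of_real t ^ r)) \<le> B * C * exp (\<epsilon> * t)" if t: "t \<ge> 0" for t
    proof -
      have "norm (integral {0<..<1} (\<lambda>x. k x * (\<Sum>r. v r * of_real (x * t) ^ r)))
          \<le> integral {0<..<1} (\<lambda>x. norm (k x) * (C * exp (\<epsilon> * t)))"
      proof (intro integral_norm_bound_integral integrable_on_mult_left kn has_integral_integrable[OF int])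
        fix x :: real assume x: "x \<in> {0<..<1}"
        hence "norm (\<Sum>r. v r * of_real (x * t) ^ r) \<le> C * exp (\<epsilon> * (x * t))"
          using t by (intro C) auto
        also have "\<dots> \<le> C * exp (\<epsilon> * t)"
          using x t \<epsilon> C(1) by (intro mult_left_mono) (auto simp: mult_left_le_one_le)
        finally show "norm (k x * (\<Sum>r. v r * of_real (x * t) ^ r)) \<le> norm (k x) * (C * exp (\<epsilon> * t))"
          unfolding norm_mult by (intro mult_left_mono) auto
      qed
      thus ?thesis using integral_unique[OF int[of t]] by (simp add: B_def mult_ac)
    qed
    thus "\<exists>C. \<forall>t\<ge>0. norm (\<Sum>r. w r * (v r * of_real t ^ r)) \<le> C * exp (\<epsilon> * t)" by blast
  qed
  thus "subexponential (\<lambda>t. \<Sum>r. of_nat r ^ j * (w r * u r) * complex_of_real t ^ r)"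
    by (simp add: v_def mult_ac)
qed

text \<open>The Beta kernel requires \<open>Re a < Re b\<close>. Otherwise \<open>b\<close> is
  raised in \<open>n\<close> unit steps by means of
  \<open>1 / pochhammer b r = (b + r) / (b * pochhammer (b + 1) r)\<close>; the extra factor is
  linear in \<open>r\<close> and preserves tameness.\<close>

lemma tame_coeffs_pochhammer_quotient:
  assumes u: "tame_coeffs u" and a: "Re a > 0" and b: "b \<notin> \<int>\<^sub>\<le>\<^sub>0"
  shows "tame_coeffs (\<lambda>r. pochhammer a r / pochhammer b r * u r)"
proof -
  obtain n :: nat where "real n > Re a - Re b" using reals_Archimedean2 by blast
  hence "Re (b + of_nat n) > Re a" by simp
  thus ?thesis using b
  proof (induction n arbitrary: b)
    case 0
    obtain k where "\<And>r. (\<lambda>x. of_real x ^ r * k x) absolutely_integrable_on {0<..<1}"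
      "\<And>r. ((\<lambda>x. of_real x ^ r * k x) has_integral (pochhammer a r / pochhammer b r)) {0<..<1}"
      using pochhammer_quotient_moments[OF a] 0 by auto
    thus ?case by (rule tame_coeffs_moments[OF u])
  next
    case (Suc n)
    have b': "b + 1 \<notin> \<int>\<^sub>\<le>\<^sub>0" using Suc.prems(2) plus_one_in_nonpos_Ints_imp by blast
    have b0: "b \<noteq> 0" using Suc.prems(2) by auto
    have "tame_coeffs (\<lambda>r. pochhammer a r / pochhammer (b + 1) r * u r)"
      using Suc.prems b' by (intro Suc.IH) (auto simp: algebra_simps)
    hence "tame_coeffs (\<lambda>r. 1 / b * ((b + of_nat r) * (pochhammer a r / pochhammer (b + 1) r * u r)))"
      by (intro tame_coeffs_cmult tame_coeffs_linear_factor)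
    also have "(\<lambda>r. 1 / b * ((b + of_nat r) * (pochhammer a r / pochhammer (b + 1) r * u r))) =
        (\<lambda>r. pochhammer a r / pochhammer b r * u r)"
    proof
      fix r
      have eq: "b * pochhammer (b + 1) r = pochhammer b r * (b + of_nat r)"
        by (metis pochhammer_Suc pochhammer_rec)
      moreover have "pochhammer b r \<noteq> 0" "pochhammer (b + 1) r \<noteq> 0"
        using Suc.prems(2) b' pochhammer_eq_0_imp_nonpos_Int by blast+
      ultimately have "(b + of_nat r) / (b * pochhammer (b + 1) r) = 1 / pochhammer b r"
        using b0 by (metis div_self mult_eq_0_iff nonzero_divide_mult_cancel_right)
      thus "1 / b * ((b + of_nat r) * (pochhammer a r / pochhammer (b + 1) r * u r)) =
          pochhammer a r / pochhammer b r * u r"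
        by (metis (no_types, opaque_lifting) divide_divide_eq_left mult.commute mult.left_commute mult_1 times_divide_eq_left)
    qed
    finally show ?case .
  qed
qed

text \<open>The first \<open>m\<close> terms form a polynomial, and the rest is \<open>t ^ m\<close>
  times the shifted series.\<close>

lemma subexponential_powser_unshift:
  assumes "\<And>t. summable (\<lambda>r. u (r + m) * complex_of_real t ^ r)"
    and "subexponential (\<lambda>t. \<Sum>r. u (r + m) * complex_of_real t ^ r)"
  shows "subexponential (\<lambda>t. \<Sum>r. u r * complex_of_real t ^ r)"
proof -
  have "(\<Sum>r. u r * complex_of_real t ^ r) =
      complex_of_real t ^ m * (\<Sum>r. u (r + m) * of_real t ^ r) + (\<Sum>r<m. u r * of_real t ^ r)" for t
  proof -
    have 1: "(\<lambda>r. u (r + m) * complex_of_real t ^ (r + m)) sums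
        (complex_of_real t ^ m * (\<Sum>r. u (r + m) * of_real t ^ r))"
      using sums_mult[OF summable_sums[OF assms(1)[of t]], of "complex_of_real t ^ m"]
      by (simp add: power_add mult_ac)
    hence "summable (\<lambda>r. u r * complex_of_real t ^ r)"
      using summable_iff_shift[of "\<lambda>r. u r * complex_of_real t ^ r" m] sums_summable by blast
    from suminf_split_initial_segment[OF this, of m] show ?thesis
      using sums_unique[OF 1] by simp
  qed
  thus ?thesis by (simp only:) (intro subexponential_intros assms)
qed

section \<open>Growth of the hypergeometric-Mittag-Leffler function\<close>

lemma Gamma_add_bounds:
  fixes x \<alpha> :: real
  assumes "\<alpha> > 0"
  shows "x > 0 \<Longrightarrow> Gamma (x + \<alpha>) \<le> Gamma x * (x + \<alpha>) powr \<alpha>"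
    and "x > 1 \<Longrightarrow> Gamma x * (x - 1) powr \<alpha> \<le> Gamma (x + \<alpha>)"
proof -
  let ?f = "ln \<circ> Gamma :: real \<Rightarrow> real"
  \<comment> \<open>By convexity of \<open>ln \<circ> Gamma\<close> the slope over
    \<open>[x, x + \<alpha>]\<close> lies between the slopes over the unit intervals ending at
    \<open>x\<close> and starting at \<open>x + \<alpha>\<close>. By the functional equation these
    are \<open>ln (x - 1)\<close> and \<open>ln (x + \<alpha>)\<close>.\<close>
  have step: "?f (y + 1) - ?f y = ln y" if "y > 0" for y
  proof -
    have "Gamma (y + 1) = y * Gamma y"
      using that by (intro Gamma_plus1) (auto elim!: nonpos_Ints_cases)
    moreover have "ln (y * Gamma y) = ln y + ln (Gamma y)"
      using that by (intro ln_mult_pos Gamma_real_pos)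
    ultimately show ?thesis by simp
  qed
  have slope: "(?f t - ?f x) / (t - x) \<le> (?f y - ?f t) / (y - t)" if "0 < x" "x < t" "t < y" for x t y
  proof -
    have "(?f x - ?f t) / (x - t) \<le> (?f t - ?f y) / (t - y)"
      using convex_on_slope_le[OF log_convex_Gamma_real, of x y t] that by force
    thus ?thesis by (metis minus_diff_eq minus_divide_divide)
  qed
  {
    assume x: "x > 0"
    have "(?f (x + \<alpha>) - ?f x) / \<alpha> \<le> ln (x + \<alpha>)"
      using slope[of x "x + \<alpha>" "x + \<alpha> + 1"] step[of "x + \<alpha>"] x assms by simp
    hence "ln (Gamma (x + \<alpha>)) \<le> ln (Gamma x) + \<alpha> * ln (x + \<alpha>)"
      using assms by (simp add: field_simps)
    also have "\<dots> = ln (Gamma x * (x + \<alpha>) powr \<alpha>)"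
      using x assms by (simp add: ln_mult_pos Gamma_real_pos ln_powr)
    finally show "Gamma (x + \<alpha>) \<le> Gamma x * (x + \<alpha>) powr \<alpha>"
      using x assms by (subst (asm) ln_le_cancel_iff) (auto intro!: mult_pos_pos Gamma_real_pos)
  }
  {
    assume x: "x > 1"
    have "ln (x - 1) \<le> (?f (x + \<alpha>) - ?f x) / \<alpha>"
      using slope[of "x - 1" x "x + \<alpha>"] step[of "x - 1"] x assms by simp
    hence le: "ln (Gamma x) + \<alpha> * ln (x - 1) \<le> ln (Gamma (x + \<alpha>))"
      using assms by (simp add: field_simps)
    have "ln (Gamma x * (x - 1) powr \<alpha>) = ln (Gamma x) + \<alpha> * ln (x - 1)"
      using x assms by (simp add: ln_mult_pos Gamma_real_pos ln_powr)
    also note le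
    finally show "Gamma x * (x - 1) powr \<alpha> \<le> Gamma (x + \<alpha>)"
      using x assms by (subst (asm) ln_le_cancel_iff) (auto intro!: mult_pos_pos Gamma_real_pos)
  }
qed

text \<open>From some index on the factors have norm at least 1, so the norms of \<open>d\<close>
  never again fall below a fixed nonzero value.\<close>

lemma not_tendsto_zero_ratio_at_top:
  fixes d q :: "nat \<Rightarrow> complex"
  assumes rec: "\<And>r. d (Suc r) = d r * q r" and nz: "\<And>r. d r \<noteq> 0"
    and q: "filterlim (\<lambda>r. norm (q r)) at_top sequentially"
  shows "\<not> d \<longlonglongrightarrow> 0"
proof
  assume lim: "d \<longlonglongrightarrow> 0"
  obtain N where N: "\<And>r. r \<ge> N \<Longrightarrow> norm (q r) \<ge> 1"
    using q unfolding filterlim_at_top eventually_sequentially by blast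
  have "norm (d r) \<ge> norm (d N)" if "r \<ge> N" for r
    using that
  proof (induction r rule: dec_induct)
    case (step r)
    have "norm (d N) * 1 \<le> norm (d r) * norm (q r)"
      using step N[of r] by (intro mult_mono) auto
    thus ?case by (simp add: rec norm_mult)
  qed auto
  hence "norm (d N) \<le> norm (0 :: complex)"
    by (intro tendsto_lowerbound[OF tendsto_norm[OF lim]]) (auto simp: eventually_sequentially)
  thus False using nz by simp
qed

text \<open>Eventually each step multiplies the norm by less than \<open>\<epsilon>\<close>; the
  constant \<open>K\<close>, a sum of rescaled early terms, covers the finitely many indices before
  that.\<close>

lemma geometric_bound_ratio_tendsto_zero:
  fixes d q :: "nat \<Rightarrow> complex"
  assumes rec: "\<And>r. d (Suc r) = d r * q r" and q: "q \<longlonglongrightarrow> 0" and \<epsilon>: "\<epsilon> > 0"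
  obtains K where "\<And>r. norm (d r) \<le> K * \<epsilon> ^ r"
proof -
  obtain N where N: "\<And>r. r \<ge> N \<Longrightarrow> norm (q r) < \<epsilon>"
    using LIMSEQ_D[OF q \<epsilon>] by auto
  define K where "K = (\<Sum>r\<le>N. norm (d r) / \<epsilon> ^ r)"
  have small: "norm (d r) \<le> K * \<epsilon> ^ r" if "r \<le> N" for r
  proof -
    have "norm (d r) / \<epsilon> ^ r \<le> K"
      unfolding K_def using that \<epsilon> by (intro member_le_sum) auto
    thus ?thesis using \<epsilon> by (simp add: field_simps)
  qed
  have "norm (d r) \<le> K * \<epsilon> ^ r" if "r \<ge> N" for r
    using that
  proof (induction r rule: dec_induct)
    case (step r)
    have "norm (d r) * norm (q r) \<le> (K * \<epsilon> ^ r) * \<epsilon>"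
      using step N[of r] \<epsilon> by (intro mult_mono) (auto intro: order_trans[OF norm_ge_zero])
    thus ?case by (simp add: rec norm_mult mult_ac)
  qed (use small in auto)
  with small that show ?thesis by (meson nat_le_linear)
qed

text \<open>Coefficients bounded by \<open>K * \<epsilon> ^ r / fact r\<close> give a series
  dominated by that of \<open>K * exp (\<epsilon> * t)\<close>.\<close>

lemma subexponential_of_geometric_bounds:
  fixes u :: "nat \<Rightarrow> complex"
  assumes "\<And>\<epsilon>. \<epsilon> > 0 \<Longrightarrow> \<exists>K. \<forall>r. norm (fact r * u r) \<le> K * \<epsilon> ^ r"
  shows "subexponential (\<lambda>t. \<Sum>r. u r * of_real t ^ r)"
  unfolding subexponential_def
proof (intro allI impI)
  fix \<epsilon> :: real assume "\<epsilon> > 0"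
  then obtain K where K: "\<And>r. norm (fact r * u r) \<le> K * \<epsilon> ^ r" using assms by blast
  have "norm (\<Sum>r. u r * of_real t ^ r) \<le> K * exp (\<epsilon> * t)" if t: "t \<ge> 0" for t
  proof -
    have s: "(\<lambda>r. K * ((\<epsilon> * t) ^ r /\<^sub>R fact r)) sums (K * exp (\<epsilon> * t))"
      by (intro sums_mult exp_converges)
    have "norm (u r * of_real t ^ r) \<le> K * ((\<epsilon> * t) ^ r /\<^sub>R fact r)" for r
    proof -
      have "norm (u r) \<le> K * \<epsilon> ^ r / fact r"
        using K[of r] by (simp add: norm_mult field_simps)
      from mult_right_mono[OF this, of "t ^ r"] show ?thesis
        using t by (simp add: norm_mult norm_power power_mult_distrib field_simps)
    qed
    from norm_suminf_le[OF this sums_summable[OF s]] show ?thesis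
      by (simp only: sums_unique[OF s, symmetric])
  qed
  thus "\<exists>C. \<forall>t\<ge>0. norm (\<Sum>r. u r * of_real t ^ r) \<le> C * exp (\<epsilon> * t)" by blast
qed

section \<open>The coefficients in powers of t, their ratios, and the growth for each range of
  \<alpha>\<close>

definition hyp_ML_coeff :: "complex \<Rightarrow> complex \<Rightarrow> complex \<Rightarrow> real \<Rightarrow> real \<Rightarrow> nat \<Rightarrow> complex" where
  "hyp_ML_coeff a\<^sub>1 a\<^sub>2 b \<alpha> \<beta> r =
     pochhammer a\<^sub>1 r * pochhammer a\<^sub>2 r / pochhammer b r * (-1) ^ r / of_real (Gamma (\<alpha> * real r + \<beta>))"

lemma hyp_ML_term_2_1:
  "hyp_ML_term [a\<^sub>1, a\<^sub>2] [b] \<alpha> \<beta> (- u) r = hyp_ML_coeff a\<^sub>1 a\<^sub>2 b \<alpha> \<beta> r * u ^ r"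
  unfolding hyp_ML_term_def hyp_ML_coeff_def Gamma_complex_of_real power_minus[of u] by simp

text \<open>The additional parameter 1 contributes \<open>pochhammer 1 r = fact r\<close>, the very
  factor that the Laplace transform of \<open>t ^ r\<close> produces.\<close>

lemma hyp_ML_term_3_1:
  "hyp_ML_term [a\<^sub>1, a\<^sub>2, 1] [b] \<alpha> \<beta> (- (1 / s)) r = fact r * hyp_ML_coeff a\<^sub>1 a\<^sub>2 b \<alpha> \<beta> r / s ^ r"
  unfolding hyp_ML_term_def hyp_ML_coeff_def Gamma_complex_of_real power_minus[of "1 / s"]
  by (simp add: pochhammer_fact[symmetric] power_divide mult_ac)

context
  fixes a\<^sub>1 a\<^sub>2 b :: complex and \<alpha> \<beta> :: real
  assumes \<alpha>: "\<alpha> > 0" and \<beta>: "\<beta> > 0" and b: "b \<notin> \<int>\<^sub>\<le>\<^sub>0"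
begin

private abbreviation "u \<equiv> hyp_ML_coeff a\<^sub>1 a\<^sub>2 b \<alpha> \<beta>"

text \<open>Quotient of consecutive values of \<open>fact r * u r\<close>, the coefficients of the
  transformed series; the factor \<open>of_nat r + 1\<close> comes from the factorial.\<close>

definition hyp_ML_ratio :: "nat \<Rightarrow> complex" where
  "hyp_ML_ratio r = - ((of_nat r + 1) * (a\<^sub>1 + of_nat r) * (a\<^sub>2 + of_nat r) / (b + of_nat r)) *
     of_real (Gamma (\<alpha> * real r + \<beta>) / Gamma (\<alpha> * real r + \<beta> + \<alpha>))"

lemma hyp_ML_coeff_Suc: "fact (Suc r) * u (Suc r) = fact r * u r * hyp_ML_ratio r"
proof -
  have "Gamma (\<alpha> * real r + \<beta>) > 0" using \<alpha> \<beta> by (intro Gamma_real_pos add_nonneg_pos) auto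
  moreover have "\<alpha> * real (Suc r) + \<beta> = \<alpha> * real r + \<beta> + \<alpha>" by (simp add: algebra_simps)
  ultimately show ?thesis
    unfolding hyp_ML_coeff_def hyp_ML_ratio_def by (simp add: pochhammer_Suc mult_ac add_ac)
qed

text \<open>Three linear factors over one make the rational part of the ratio grow like
  \<open>r ^ 2\<close>. The Gamma quotient is of order \<open>r powr (- \<alpha>)\<close>, so
  \<open>\<alpha> = 2\<close> is the critical value.\<close>

lemma hyp_ML_ratio_prefactor:
  "(\<lambda>r. norm ((of_nat r + 1) * (a\<^sub>1 + of_nat r) * (a\<^sub>2 + of_nat r) / (b + of_nat r)) / real r ^ 2) \<longlonglongrightarrow> 1"
proof -
  have lim: "(\<lambda>r. (c + of_nat r) / of_nat r) \<longlonglongrightarrow> (1::complex)" for c :: complex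
  proof -
    have "(\<lambda>r. c * inverse (of_nat r) + 1) \<longlonglongrightarrow> c * 0 + 1"
      by (intro tendsto_intros lim_inverse_n)
    moreover have "\<forall>\<^sub>F r in sequentially. c * inverse (of_nat r) + 1 = (c + of_nat r) / of_nat r"
      using eventually_gt_at_top[of 0] by eventually_elim (simp add: field_simps)
    ultimately show ?thesis by (auto dest: Lim_transform_eventually)
  qed
  have "(\<lambda>r. norm ((1 + of_nat r) / of_nat r * ((a\<^sub>1 + of_nat r) / of_nat r) * ((a\<^sub>2 + of_nat r) / of_nat r) /
      ((b + of_nat r) / of_nat r))) \<longlonglongrightarrow> norm (1 * 1 * 1 / (1::complex))"
    by (intro tendsto_intros lim) auto
  moreover have "\<forall>\<^sub>F r in sequentially. norm ((1 + of_nat r) / of_nat r * ((a\<^sub>1 + of_nat r) / of_nat r) *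
      ((a\<^sub>2 + of_nat r) / of_nat r) / ((b + of_nat r) / of_nat r)) =
      norm ((of_nat r + 1) * (a\<^sub>1 + of_nat r) * (a\<^sub>2 + of_nat r) / (b + of_nat r)) / real r ^ 2"
    using eventually_gt_at_top[of 0]
    by eventually_elim (simp add: norm_mult norm_divide power2_eq_square add_ac)
  ultimately show ?thesis by (auto dest: Lim_transform_eventually)
qed

lemma norm_hyp_ML_ratio:
  assumes "r > 0"
  shows "norm (hyp_ML_ratio r) =
    norm ((of_nat r + 1) * (a\<^sub>1 + of_nat r) * (a\<^sub>2 + of_nat r) / (b + of_nat r)) / real r ^ 2 *
     (real r ^ 2 * (Gamma (\<alpha> * real r + \<beta>) / Gamma (\<alpha> * real r + \<beta> + \<alpha>)))"
proof -
  have "\<alpha> * real r + \<beta> > 0" using \<alpha> \<beta> by (intro add_nonneg_pos) auto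
  hence "Gamma (\<alpha> * real r + \<beta>) > 0" "Gamma (\<alpha> * real r + \<beta> + \<alpha>) > 0"
    using \<alpha> by (auto intro!: Gamma_real_pos)
  thus ?thesis using assms unfolding hyp_ML_ratio_def norm_mult norm_minus_cancel norm_of_real by simp
qed

text \<open>The upper bound for \<open>Gamma (x + \<alpha>)\<close> keeps the ratio above a quantity
  of order \<open>r powr (2 - \<alpha>)\<close>, here a positive power of \<open>r\<close>.\<close>

lemma hyp_ML_ratio_at_top:
  assumes "\<alpha> < 2"
  shows "filterlim (\<lambda>r. norm (hyp_ML_ratio r)) at_top sequentially"
proof -
  have "filterlim (\<lambda>r. real r ^ 2 / (\<alpha> * real r + \<beta> + \<alpha>) powr \<alpha>) at_top sequentially"
    using \<alpha> assms by real_asymp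
  from filterlim_tendsto_pos_mult_at_top[OF hyp_ML_ratio_prefactor _ this]
  have "filterlim (\<lambda>r. norm ((of_nat r + 1) * (a\<^sub>1 + of_nat r) * (a\<^sub>2 + of_nat r) / (b + of_nat r)) / real r ^ 2 *
     (real r ^ 2 / (\<alpha> * real r + \<beta> + \<alpha>) powr \<alpha>)) at_top sequentially" by simp
  thus ?thesis
  proof (rule filterlim_at_top_mono)
    show "\<forall>\<^sub>F r in sequentially. norm ((of_nat r + 1) * (a\<^sub>1 + of_nat r) * (a\<^sub>2 + of_nat r) / (b + of_nat r)) / real r ^ 2 *
     (real r ^ 2 / (\<alpha> * real r + \<beta> + \<alpha>) powr \<alpha>) \<le> norm (hyp_ML_ratio r)"
      using eventually_gt_at_top[of 0]
    proof eventually_elim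
      case (elim r)
      define x where "x = \<alpha> * real r + \<beta>"
      have x: "x > 0" using \<alpha> \<beta> by (auto simp: x_def intro!: add_nonneg_pos)
      have "1 / (x + \<alpha>) powr \<alpha> \<le> Gamma x / Gamma (x + \<alpha>)"
        using Gamma_add_bounds(1)[OF \<alpha> x] x \<alpha> by (simp add: field_simps Gamma_real_pos)
      from mult_left_mono[OF this, of "real r ^ 2"] show ?case
        unfolding norm_hyp_ML_ratio[OF elim] x_def by (intro mult_left_mono) auto
    qed
  qed
qed

text \<open>The lower bound for \<open>Gamma (x + \<alpha>)\<close> keeps the ratio below a quantity
  of order \<open>r powr (2 - \<alpha>)\<close>, here a negative power of \<open>r\<close>.\<close>

lemma hyp_ML_ratio_tendsto_0:
  assumes "\<alpha> > 2"
  shows "hyp_ML_ratio \<longlonglongrightarrow> 0"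
proof (rule Lim_null_comparison)
  have "(\<lambda>r. real r ^ 2 / (\<alpha> * real r + \<beta> - 1) powr \<alpha>) \<longlonglongrightarrow> 0"
    using \<alpha> assms by real_asymp
  from tendsto_mult[OF hyp_ML_ratio_prefactor this]
  show "(\<lambda>r. norm ((of_nat r + 1) * (a\<^sub>1 + of_nat r) * (a\<^sub>2 + of_nat r) / (b + of_nat r)) / real r ^ 2 *
     (real r ^ 2 / (\<alpha> * real r + \<beta> - 1) powr \<alpha>)) \<longlonglongrightarrow> 0" by simp
  show "\<forall>\<^sub>F r in sequentially. norm (hyp_ML_ratio r) \<le> norm ((of_nat r + 1) * (a\<^sub>1 + of_nat r) * (a\<^sub>2 + of_nat r) / (b + of_nat r)) / real r ^ 2 *
     (real r ^ 2 / (\<alpha> * real r + \<beta> - 1) powr \<alpha>)"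
    using eventually_gt_at_top[of 0]
  proof eventually_elim
    case (elim r)
    define x where "x = \<alpha> * real r + \<beta>"
    \<comment> \<open>The lower Gamma bound needs \<open>x > 1\<close>, which
      \<open>r \<ge> 1\<close> and \<open>\<alpha> > 2\<close> ensure.\<close>
    have "\<alpha> * real r \<ge> 2 * 1" using assms elim by (intro mult_mono) auto
    hence x: "x > 1" using \<beta> by (simp add: x_def)
    hence "Gamma x > 0" "Gamma (x + \<alpha>) > 0" "(x - 1) powr \<alpha> > 0"
      using \<alpha> by (auto intro!: Gamma_real_pos)
    hence "Gamma x / Gamma (x + \<alpha>) \<le> 1 / (x - 1) powr \<alpha>"
      using Gamma_add_bounds(2)[OF \<alpha> x] by (simp add: field_simps)
    from mult_left_mono[OF this, of "real r ^ 2"] show ?case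
      unfolding norm_hyp_ML_ratio[OF elim] x_def by (intro mult_left_mono) auto
  qed
qed

text \<open>If no coefficient vanished, the unbounded ratios would keep the terms at
  \<open>s\<close> from tending to 0. So some \<open>u N\<close> is zero, the recurrence annihilates
  all later coefficients, and the function is a polynomial.\<close>

lemma subexponential_small_alpha:
  assumes "\<alpha> < 2" and "s \<noteq> 0" and sum: "summable (\<lambda>r. fact r * u r / s ^ r)"
  shows "subexponential (\<lambda>t. \<Sum>r. u r * of_real t ^ r)"
proof -
  have "\<exists>N. u N = 0"
  proof (rule ccontr)
    assume nz: "\<nexists>N. u N = 0"
    have "\<not> (\<lambda>r. fact r * u r / s ^ r) \<longlonglongrightarrow> 0"
    proof (rule not_tendsto_zero_ratio_at_top)
      show "fact (Suc r) * u (Suc r) / s ^ Suc r = fact r * u r / s ^ r * (hyp_ML_ratio r / s)" for r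
        unfolding hyp_ML_coeff_Suc by simp
      show "fact r * u r / s ^ r \<noteq> 0" for r using nz assms(2) by simp
      have "filterlim (\<lambda>r. 1 / norm s * norm (hyp_ML_ratio r)) at_top sequentially"
        using assms(2) by (intro filterlim_tendsto_pos_mult_at_top[OF tendsto_const] hyp_ML_ratio_at_top assms(1)) auto
      thus "filterlim (\<lambda>r. norm (hyp_ML_ratio r / s)) at_top sequentially"
        by (simp add: norm_divide)
    qed
    with summable_LIMSEQ_zero[OF sum] show False by contradiction
  qed
  then obtain N where N: "u N = 0" by blast
  have "fact r * u r = 0" if "r \<ge> N" for r
    using that by (induction r rule: dec_induct) (simp_all only: N hyp_ML_coeff_Suc mult_zero_left mult_zero_right)
  hence "u r = 0" if "r \<ge> N" for r using that by simp
  hence "(\<Sum>r. u r * of_real t ^ r) = (\<Sum>r<N. u r * of_real t ^ r)" for t :: real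
    by (intro suminf_finite) auto
  thus ?thesis by (simp only:) (intro subexponential_intros)
qed

text \<open>Ratios tending to 0 bound \<open>fact r * u r\<close> by geometric sequences of every
  positive rate.\<close>

lemma subexponential_large_alpha:
  assumes "\<alpha> > 2"
  shows "subexponential (\<lambda>t. \<Sum>r. u r * of_real t ^ r)"
proof (rule subexponential_of_geometric_bounds)
  fix \<epsilon> :: real assume "\<epsilon> > 0"
  from geometric_bound_ratio_tendsto_zero[of "\<lambda>r. fact r * u r", OF hyp_ML_coeff_Suc hyp_ML_ratio_tendsto_0[OF assms] this]
  show "\<exists>K. \<forall>r. norm (fact r * u r) \<le> K * \<epsilon> ^ r" by metis
qed

lemma subexponential_alpha_2:
  assumes "\<alpha> = 2"
  shows "subexponential (\<lambda>t. \<Sum>r. u r * of_real t ^ r)"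
proof -
  \<comment> \<open>Shifting the index by \<open>m\<close> gives both numerator parameters a
    positive real part, as the multiplier lemma requires.\<close>
  obtain m :: nat where m: "real m > max (- Re a\<^sub>1) (- Re a\<^sub>2)" using reals_Archimedean2 by blast
  \<comment> \<open>Here \<open>2 * z\<close> is the Gamma argument at index \<open>m\<close>, so
    the duplication formula splits \<open>pochhammer (2 * z) (2 * r)\<close> into
    \<open>4 ^ r\<close> and the symbols at \<open>z\<close> and \<open>z + 1 / 2\<close>.\<close>
  define z :: complex where "z = of_real \<beta> / 2 + of_nat m"
  define c where "c = pochhammer a\<^sub>1 m * pochhammer a\<^sub>2 m / pochhammer b m * (-1) ^ m / Gamma (2 * z)"
  have Rez: "Re z > 0" using \<beta> by (simp add: z_def add_pos_nonneg)
  have nonpos: "w \<notin> \<int>\<^sub>\<le>\<^sub>0" if "Re w > 0" for w :: complex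
    using that by (auto elim!: nonpos_Ints_cases)
  \<comment> \<open>The numerator \<open>pochhammer 1 r\<close> cancels \<open>fact r\<close>. It is
    inserted so that each of the three denominator symbols is paired with a numerator and the
    innermost series is an exponential; its rate \<open>- 1 / 4\<close> combines the sign with the
    \<open>4 ^ r\<close> of the duplication formula.\<close>
  define v where "v = (\<lambda>r. c * (pochhammer (a\<^sub>1 + of_nat m) r / pochhammer (b + of_nat m) r *
      (pochhammer (a\<^sub>2 + of_nat m) r / pochhammer z r *
       (pochhammer 1 r / pochhammer (z + 1 / 2) r * ((- 1 / 4) ^ r / fact r)))))"
  have "tame_coeffs v"
    unfolding v_def
  proof (intro tame_coeffs_cmult tame_coeffs_pochhammer_quotient tame_coeffs_exp)
    show "b + of_nat m \<notin> \<int>\<^sub>\<le>\<^sub>0"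
    proof
      assume "b + of_nat m \<in> \<int>\<^sub>\<le>\<^sub>0"
      hence "(b + of_nat m) - of_nat m \<in> \<int>\<^sub>\<le>\<^sub>0" by (intro nonpos_Ints_diff_Nats) auto
      with b show False by simp
    qed
  qed (use m nonpos[of z] nonpos[of "z + 1 / 2"] Rez in auto)
  moreover have "v r = u (r + m)" for r
  proof -
    have G: "Gamma (2 * real (r + m) + \<beta>) = Gamma (2 * z) * (4 ^ r * pochhammer z r * pochhammer (z + 1 / 2) r)"
    proof -
      have "pochhammer (2 * z) (2 * r) = Gamma (2 * z + of_nat (2 * r)) / Gamma (2 * z)"
        using Rez by (intro pochhammer_Gamma nonpos) simp
      moreover have "Gamma (2 * z) \<noteq> 0"
        using nonpos[of "2 * z"] Rez by (simp add: Gamma_eq_zero_iff)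
      ultimately have "Gamma (2 * z + of_nat (2 * r)) = Gamma (2 * z) * pochhammer (2 * z) (2 * r)"
        by simp
      also have "2 * z + of_nat (2 * r) = complex_of_real (2 * real (r + m) + \<beta>)"
        by (simp add: z_def)
      also have "pochhammer (2 * z) (2 * r) = 4 ^ r * pochhammer z r * pochhammer (z + 1 / 2) r"
        by (simp add: pochhammer_double power_mult)
      finally show ?thesis unfolding Gamma_complex_of_real .
    qed
    have p: "pochhammer w (r + m) = pochhammer w m * pochhammer (w + of_nat m) r" for w :: complex
      by (metis add.commute pochhammer_product')
    show ?thesis
      unfolding hyp_ML_coeff_def assms G p v_def c_def power_divide
      by (simp add: pochhammer_fact[symmetric] power_add mult_ac)
  qed
  ultimately show ?thesis
    using tame_coeffsD[of v 0] by (intro subexponential_powser_unshift[of u m]) auto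
qed

end

section \<open>The transform formula, combining the three ranges of \<alpha>\<close>

theorem mainTheorem12:
  fixes \<alpha> \<beta> :: real and a\<^sub>1 a\<^sub>2 b\<^sub>1 s :: complex
  assumes "\<alpha> > 0" and "\<beta> > 0"
    and "b\<^sub>1 \<notin> \<int>\<^sub>\<le>\<^sub>0"
    and "Re s > 0"
    and "summable (hyp_ML_term [a\<^sub>1, a\<^sub>2, 1] [b\<^sub>1] \<alpha> \<beta> (- (1 / s)))"
  shows "has_laplace_transform
           (\<lambda>t. hyp_ML [a\<^sub>1, a\<^sub>2] [b\<^sub>1] \<alpha> \<beta> (- complex_of_real t)) s
           (1 / s * hyp_ML [a\<^sub>1, a\<^sub>2, 1] [b\<^sub>1] \<alpha> \<beta> (- (1 / s)))"
proof -
  let ?u = "hyp_ML_coeff a\<^sub>1 a\<^sub>2 b\<^sub>1 \<alpha> \<beta>"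
  have s: "s \<noteq> 0" using assms(4) by auto
  have sum: "summable (\<lambda>r. fact r * ?u r / s ^ r)"
    using assms(5) unfolding hyp_ML_term_3_1[abs_def] .
  consider "\<alpha> < 2" | "\<alpha> = 2" | "\<alpha> > 2" by linarith
  hence "subexponential (\<lambda>t. \<Sum>r. ?u r * of_real t ^ r)"
  proof cases
    case 1
    thus ?thesis using subexponential_small_alpha[OF assms(1-3) 1 s sum] by simp
  next
    case 2
    thus ?thesis using subexponential_alpha_2[OF assms(1-3) 2] by simp
  next
    case 3
    thus ?thesis using subexponential_large_alpha[OF assms(1-3) 3] by simp
  qed
  from has_laplace_transform_power_series[OF assms(4) sum this] show ?thesis
    unfolding hyp_ML_def hyp_ML_term_3_1 hyp_ML_term_2_1 .
qed

end
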